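(* Consider the robust FNC problem over the horizon $\{0,1,\dots,T\}$, with optimal value $\mathcal C^*=\min_{\pi\in\Pi}\max_{\omega\in\Omega}\mathrm{TTS}(\pi,\omega)$, for a network with controlled merging flows satisfying the graph assumption and with uncertainty sets of the form described in the context. Let $\rho^*(t),\phi^*(t)$ denote an optimizer of the deterministic FNC problem for $\omega=\overline\omega$, solved once for the complete horizon $t\in\{0,1,\dots,T\}$. Let $T_c\ge 1$ be a control horizon and, for each $t$, put $t_c:=\min\{t+T_c,T\}$. Consider the receding horizon policy based on the convex optimization problem, to be solved at each time $t$ for the observed state $\rho(t)$, $$\begin{array}{rll}\text{minimize}\limits_{\phi(\tau),\rho(\tau)} & \sum_{\tau=t+1}^{t_c} l^\top\rho(\tau) & \\ \text{subject to} & \rho_e(\tau+1)=\rho_e(\tau)+\frac{\Delta t}{l_e}\Big(\sum_{i\in\mathcal E}\beta_{e,i}\phi_i(\tau)-\phi_e(\tau)+\overline w_e(\tau)\Big) & \forall e\in\mathcal E,\\ & \rho_e(\tau)\le\bar s_e & \forall e\in\mathcal S,\\ & 0\le\phi_e(\tau)\le\underline d_e(\rho_e(\tau)) & \forall e\in\mathcal E,\\ & \sum_{i\in\mathcal E}\beta_{e,i}\phi_i(\tau)\le\underline s_e(\rho_e(\tau)) & \forall e\notin\mathcal S,\\ & PL\big(\rho(t_c)-\rho^*(t_c)\big)\le 0 & \text{(componentwise)},\\ & \text{initial state }\rho(t)\text{ given}.&\end{array}$$ The control policy selects the controlled flows $\phi_e(t)$, $e\in\mathcal N$, at time $t$ equal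 to the corresponding values of a minimizer of this problem (any minimizer may be chosen). Then this policy is well-defined (all these optimization problems, encountered in closed loop for any $\omega\in\Omega$, are feasible), it is feasible (the resulting closed-loop trajectory satisfies all input and ramp constraints for every $\omega\in\Omega$), and it achieves total cost (TTS) $\mathcal C^*_{\mathrm{MPC}}\le\mathcal C^*$, i.e. its TTS is at most $\mathcal C^*$ for every $\omega\in\Omega$.
   Context: **Network.** $\mathcal G=(\mathcal V,\mathcal E)$ is a finite directed graph; its edges $e\in\mathcal E\subset\mathcal V\times\mathcal V$ are called cells, its vertices junctions. Traffic in cell $e$ flows from its tail $\tau_e$ to its head $\sigma_e$. With $\deg^-,\deg^+$ the in- and out-degree, let $\mathcal M=\{v:\deg^-(v)>1\}$ (merging junctions), $\mathcal S=\{e:\deg^-(\tau_e)=0\}$ (source cells), and $\mathcal E^+(e)=\{i:\tau_i=\sigma_e\}$; a minimum over the empty set is $+\infty$. Cell $e$ has length $l_e>0$; $l=(l_e)_e$, $L=\mathrm{diag}(l_e)$; $\Delta t>0$ is the sampling time. Split ratios: $\beta_{e,i}>0$ if $\tau_e=\sigma_i$ (fraction of the outflow of cell $i$ entering cell $e$), $\beta_{e,i}=0$ otherwise, and $\sum_{i\in\mathcal E}\beta_{i,e}\le 1$ for every $e$. The routing matrix $R$ has entries $R_{e,i}=\beta_{e,i}$. **Graph assumption.** $\mathcal G$ has no self loops; $\deg^+(v)=1$ for all $v\in\mathcal M$; for every edge $j$ there is a directed path (along edges with nonzero split ratios) to some edge $e$ with $\sum_{i}\beta_{i,e}<1$. **Merging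 junctions.** Each merging junction is either a controlled junction (all flows into it are controlled) or an asymmetric junction. An asymmetric junction has exactly two upstream cells, an onramp $e$ and a mainline cell $i$, and one downstream cell $j$, with $\beta_{j,e}=\beta_{j,i}=1$; the onramp flow $\phi_e(t)$ is controlled subject only to $0\le\phi_e(t)\le d_{t,e}(\rho_e(t))$, and the mainline flow is $\phi_i(t)=\min\{d_{t,i}(\rho_i(t)),\,s_{t,j}(\rho_j(t))-\phi_e(t)\}$. If asymmetric junctions are present, it is assumed that $d_{t,e}(\rho_e(t))\le s_{t,j}(\rho_j(t))$ for all onramps $e$ with downstream cell $j$, for all $\omega\in\Omega$, any feasible control policy and all $t\ge0$. $\mathcal N$ is the set of cells with controlled outflow: all cells entering a controlled junction and all onramp cells (but not mainline cells) entering asymmetric junctions. **Fundamental diagram assumption** (for the functions $\underline d_e,\underline s_e$). For each cell there is a traffic jam density $\bar\rho_e$. The demand function $\underline d_e:[0,\bar\rho_e]\to[0,\infty)$ is concave, Lipschitz with constant $\gamma$, nondecreasing, $\underline d_e(0)=0$. The supply function $\underline s_e:[0,\bar\rho_e]\to[0,\infty)$ is concave, Lipschitz with constant $\gamma$, nonincreasing, $\underline s_e(\bar\rho_e)=0$. Moreover $\Delta t\le l_e/\gamma$ for all $e$. Cells of infinite capacity are allowed: $\bar\rho_e=+\infty$, $\underline s_e\equiv+\infty$, with $\underline d_e$ defined on $[0,\infty)$. All source cells have infinite capacity. The given initial state $\rho(0)$ lies in $\prod_e[0,\bar\rho_e]$ (with $[0,\infty)$ for infinite-capacity cells). **Uncertainty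 sets.** External demands satisfy $0\le w_e(t)\le\overline w_e(t)$, with $w_e(t)=0$ for $e\notin\mathcal S$. Realized demand functions lie in $\Omega_{d,e}=\{d_{t,e}:[0,\infty)\to[0,\infty):\ \underline d_e(\rho)\le d_{t,e}(\rho)\ \forall\rho\in[0,\bar\rho_e],\ d_{t,e}(\rho)\le\gamma\rho\ \forall\rho\}$, realized supply functions in $\Omega_{s,e}=\{s_{t,e}:[0,\infty)\to[0,\infty):\ \underline s_e(\rho)\le s_{t,e}(\rho)\ \forall\rho\in[0,\bar\rho_e]\}$ (value $+\infty$ allowed for cells of infinite capacity). $\Omega$ is the set of all tuples $\omega$ of $w_e(t),d_{t,e},s_{t,e}$ over all $e\in\mathcal E$, $t\in\{0,\dots,T\}$ with these properties. $\overline\omega\in\Omega$ denotes the tuple with $w_e(t)=\overline w_e(t)$, $d_{t,e}=\underline d_e$, $s_{t,e}=\underline s_e$ for all $e,t$. **Dynamics.** For realization $\omega$, $\rho_e(t+1)=\rho_e(t)+\frac{\Delta t}{l_e}\big(\sum_i\beta_{e,i}\phi_i(t)-\phi_e(t)+w_e(t)\big)$. Flows out of cells not entering a merging junction are $\phi_e(t)=\min\{d_{t,e}(\rho_e(t)),\ \min_{i\in\mathcal E^+(e)}\frac{1}{\beta_{i,e}}s_{t,i}(\rho_i(t))\}$; the flow out of the mainline cell $i$ of an asymmetric junction with onramp $e$ and downstream cell $j$ is $\phi_i(t)=\min\{d_{t,i}(\rho_i(t)),\,s_{t,j}(\rho_j(t))-\phi_e(t)\}$. Controlled flows satisfy $0\le\phi_e(t)\le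 d_{t,e}(\rho_e(t))$ for $e\in\mathcal N$ and $\sum_i\beta_{e,i}\phi_i(t)\le s_{t,e}(\rho_e(t))$ for all $e$ with $\tau_e$ a controlled merging junction. In addition, ramp constraints $\rho_e(t)\le\bar s_e$, $e\in\mathcal S$, are imposed, with given constants $\bar s_e$. **Problems.** The deterministic FNC problem for $\omega$ minimizes $\mathrm{TTS}=\Delta t\sum_{t=0}^T\sum_e l_e\rho_e(t)$ over trajectories $(\rho,\phi)$ satisfying these dynamics and constraints, with $\rho(0)$ given. A policy $\pi=(\pi_t)_{t=0}^T$ consists of maps $\pi_t:[0,\infty)^{\mathcal E}\to[0,\infty)^{\mathcal N}$, $\phi_e(t)=\pi_{t,e}(\rho(t))$ for $e\in\mathcal N$; $\Pi$ is the set of policies for which the input and ramp constraints hold along the closed-loop trajectory from $\rho(0)$ for every $\omega\in\Omega$; $\mathrm{TTS}(\pi,\omega)$ is the TTS of the closed-loop trajectory. **Reduced routing matrix.** $\underline R_{i,j}=0$ if $j\in\mathcal N$ and $\underline R_{i,j}=R_{i,j}$ otherwise; $P=(I-\underline R)^{-1}$ (which exists).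
   Formalization: Above the traffic jam density, where the nominal functions are undefined, nominal demand is taken constant and nominal supply zero, and realized demands must there be at least the nominal demand at the jam density; otherwise the online problem can be undefined or infeasible. *)

theory Defs
  imports "HOL-Analysis.Analysis" "Graph_Theory.Digraph"
begin

text \<open>
  The cells are the elements of a finite type (the whole arc set of the digraph), so that
  densities, flows and routing matrices are vectors and matrices indexed by cells.
  \<^term>\<open>split_ratio N e i\<close> is the fraction of the outflow of cell \<open>i\<close> that enters cell \<open>e\<close>.
  Only finite-capacity cells use \<open>nominal_supply\<close>; an infinite jam density marks a cell of
  infinite capacity.  The nominal functions matter on \<open>[0, jam_density]\<close> only.
\<close>

record ('v, 'e::finite) fnc_network =
  graph :: "('v, 'e) pre_digraph"
  asym_junctions :: "'v set"
  onramp :: "'v \<Rightarrow> 'e"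
  split_ratio :: "'e \<Rightarrow> 'e \<Rightarrow> real"
  cell_length :: "'e \<Rightarrow> real"
  sampling_time :: real
  lip :: real
  jam_density :: "'e \<Rightarrow> ereal"
  nominal_demand :: "'e \<Rightarrow> real \<Rightarrow> real"
  nominal_supply :: "'e \<Rightarrow> real \<Rightarrow> real"
  inflow_bound :: "nat \<Rightarrow> 'e \<Rightarrow> real"
  ramp_limit :: "'e \<Rightarrow> real"
  initial_density :: "real ^ 'e"
  horizon :: nat

record 'e realization =
  realized_inflow :: "nat \<Rightarrow> 'e \<Rightarrow> real"
  realized_demand :: "nat \<Rightarrow> 'e \<Rightarrow> real \<Rightarrow> real"
  realized_supply :: "nat \<Rightarrow> 'e \<Rightarrow> real \<Rightarrow> ereal"


section \<open>Network structure\<close>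

definition merging_junctions :: "('v, 'e::finite) fnc_network \<Rightarrow> 'v set" where
  "merging_junctions N = {v \<in> verts (graph N). in_degree (graph N) v > 1}"

definition controlled_junctions :: "('v, 'e::finite) fnc_network \<Rightarrow> 'v set" where
  "controlled_junctions N = merging_junctions N - asym_junctions N"

definition source_cells :: "('v, 'e::finite) fnc_network \<Rightarrow> 'e set" where
  "source_cells N = {e. in_degree (graph N) (tail (graph N) e) = 0}"

definition downstream_cells :: "('v, 'e::finite) fnc_network \<Rightarrow> 'e \<Rightarrow> 'e set" where
  "downstream_cells N e = out_arcs (graph N) (head (graph N) e)"

text \<open>The cells with controlled outflow.\<close>

definition controlled_cells :: "('v, 'e::finite) fnc_network \<Rightarrow> 'e set" where
  "controlled_cells N =
     {e. head (graph N) e \<in> controlled_junctions N} \<union> onramp N ` asym_junctions N"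

text \<open>\<open>e\<close>, \<open>i\<close>, \<open>j\<close> are the onramp, the mainline cell and the downstream cell.\<close>

definition asymmetric_at ::
    "('v, 'e::finite) fnc_network \<Rightarrow> 'v \<Rightarrow> 'e \<Rightarrow> 'e \<Rightarrow> 'e \<Rightarrow> bool" where
  "asymmetric_at N v e i j \<longleftrightarrow>
     v \<in> asym_junctions N \<and> e = onramp N v \<and> e \<noteq> i \<and>
     in_arcs (graph N) v = {e, i} \<and> out_arcs (graph N) v = {j} \<and>
     split_ratio N j e = 1 \<and> split_ratio N j i = 1"

definition network_structure :: "('v, 'e::finite) fnc_network \<Rightarrow> bool" where
  "network_structure N \<longleftrightarrow>
     fin_digraph (graph N) \<and> nomulti_digraph (graph N) \<and> arcs (graph N) = UNIV \<and>
     (\<forall>e. cell_length N e > 0) \<and> sampling_time N > 0 \<and>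
     (\<forall>e i. if tail (graph N) e = head (graph N) i
            then split_ratio N e i > 0 else split_ratio N e i = 0) \<and>
     (\<forall>e. (\<Sum>i\<in>UNIV. split_ratio N i e) \<le> 1) \<and>
     asym_junctions N \<subseteq> merging_junctions N \<and>
     (\<forall>v\<in>asym_junctions N. \<exists>e i j. asymmetric_at N v e i j)"

definition graph_assumption :: "('v, 'e::finite) fnc_network \<Rightarrow> bool" where
  "graph_assumption N \<longleftrightarrow>
     loopfree_digraph (graph N) \<and>
     (\<forall>v\<in>merging_junctions N. out_degree (graph N) v = 1) \<and>
     (\<forall>j. \<exists>e. (j, e) \<in> {(i, k). split_ratio N k i \<noteq> 0}\<^sup>* \<and> (\<Sum>i\<in>UNIV. split_ratio N i e) < 1)"


section \<open>Fundamental diagram\<close>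

definition density_range :: "('v, 'e::finite) fnc_network \<Rightarrow> 'e \<Rightarrow> real set" where
  "density_range N e = {\<rho>. 0 \<le> \<rho> \<and> ereal \<rho> \<le> jam_density N e}"

definition fundamental_diagram :: "('v, 'e::finite) fnc_network \<Rightarrow> bool" where
  "fundamental_diagram N \<longleftrightarrow>
     (\<forall>e. (\<forall>\<rho>\<in>density_range N e. nominal_demand N e \<rho> \<ge> 0) \<and>
          concave_on (density_range N e) (nominal_demand N e) \<and>
          lipschitz_on (lip N) (density_range N e) (nominal_demand N e) \<and>
          mono_on (density_range N e) (nominal_demand N e) \<and>
          nominal_demand N e 0 = 0) \<and>
     (\<forall>e. jam_density N e \<noteq> \<infinity> \<longrightarrow>
          (\<forall>\<rho>\<in>density_range N e. nominal_supply N e \<rho> \<ge> 0) \<and>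
          concave_on (density_range N e) (nominal_supply N e) \<and>
          lipschitz_on (lip N) (density_range N e) (nominal_supply N e) \<and>
          antimono_on (density_range N e) (nominal_supply N e) \<and>
          nominal_supply N e (real_of_ereal (jam_density N e)) = 0) \<and>
     (\<forall>e. sampling_time N * lip N \<le> cell_length N e) \<and>
     (\<forall>e\<in>source_cells N. jam_density N e = \<infinity>) \<and>
     (\<forall>e. initial_density N $ e \<in> density_range N e)"

text \<open>
  Realized functions live on \<open>[0, \<infinity>)\<close>, and a realized supply may let a density exceed the
  nominal jam density.  The worst-case realization and the optimization problems solved online
  therefore need the nominal functions on \<open>[0, \<infinity>)\<close>: above the jam density the demand keeps
  its value at the jam density and the supply is zero.
\<close>

definition demand_lb :: "('v, 'e::finite) fnc_network \<Rightarrow> 'e \<Rightarrow> real \<Rightarrow> real" where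
  "demand_lb N e \<rho> =
     (if ereal \<rho> \<le> jam_density N e then nominal_demand N e \<rho>
      else nominal_demand N e (real_of_ereal (jam_density N e)))"

definition supply_lb :: "('v, 'e::finite) fnc_network \<Rightarrow> 'e \<Rightarrow> real \<Rightarrow> ereal" where
  "supply_lb N e \<rho> =
     (if jam_density N e = \<infinity> then \<infinity>
      else if ereal \<rho> \<le> jam_density N e then ereal (nominal_supply N e \<rho>) else 0)"


section \<open>Uncertainty\<close>

definition inflow_bounds_ok :: "('v, 'e::finite) fnc_network \<Rightarrow> bool" where
  "inflow_bounds_ok N \<longleftrightarrow>
     (\<forall>t\<le>horizon N. \<forall>e. 0 \<le> inflow_bound N t e \<and>
        (e \<notin> source_cells N \<longrightarrow> inflow_bound N t e = 0))"

text \<open>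
  The lower bounds are imposed at all densities \<open>\<rho> \<ge> 0\<close>, through the extensions above.  For the
  supply this adds nothing to the bound on \<open>[0, jam_density]\<close>.  Without it for the demand, a
  realization could drive a cell beyond its nominal jam density and then block its outflow
  forever, and the terminal constraint of the receding horizon problem would become infeasible.
\<close>

definition uncertainty_set :: "('v, 'e::finite) fnc_network \<Rightarrow> 'e realization set" where
  "uncertainty_set N = {\<omega>. \<forall>t\<le>horizon N. \<forall>e.
     0 \<le> realized_inflow \<omega> t e \<and> realized_inflow \<omega> t e \<le> inflow_bound N t e \<and>
     (e \<notin> source_cells N \<longrightarrow> realized_inflow \<omega> t e = 0) \<and>
     (\<forall>\<rho>\<ge>0. 0 \<le> realized_demand \<omega> t e \<rho> \<and> demand_lb N e \<rho> \<le> realized_demand \<omega> t e \<rho> \<and>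
             realized_demand \<omega> t e \<rho> \<le> lip N * \<rho>) \<and>
     (\<forall>\<rho>\<ge>0. 0 \<le> realized_supply \<omega> t e \<rho> \<and> supply_lb N e \<rho> \<le> realized_supply \<omega> t e \<rho> \<and>
             (jam_density N e \<noteq> \<infinity> \<longrightarrow> realized_supply \<omega> t e \<rho> \<noteq> \<infinity>))}"

definition worst_case :: "('v, 'e::finite) fnc_network \<Rightarrow> 'e realization" where
  "worst_case N =
     \<lparr>realized_inflow = inflow_bound N, realized_demand = (\<lambda>t. demand_lb N),
      realized_supply = (\<lambda>t. supply_lb N)\<rparr>"


section \<open>Dynamics and constraints\<close>

definition next_density ::
    "('v, 'e::finite) fnc_network \<Rightarrow> ('e \<Rightarrow> real) \<Rightarrow> real ^ 'e \<Rightarrow> real ^ 'e \<Rightarrow> real ^ 'e" where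
  "next_density N w \<rho> \<phi> = (\<chi> e. \<rho> $ e + sampling_time N / cell_length N e *
     ((\<Sum>i\<in>UNIV. split_ratio N e i * \<phi> $ i) - \<phi> $ e + w e))"

text \<open>
  All flows at density \<open>\<rho>\<close> when the controlled flows are the corresponding components of \<open>u\<close>;
  the other components of \<open>u\<close> are not used.  The infimum over the empty set is \<open>\<infinity>\<close>.
\<close>

definition flows ::
    "('v, 'e::finite) fnc_network \<Rightarrow> 'e realization \<Rightarrow> nat \<Rightarrow> real ^ 'e \<Rightarrow> real ^ 'e \<Rightarrow> real ^ 'e" where
  "flows N \<omega> t \<rho> u = (\<chi> i.
     if i \<in> controlled_cells N then u $ i
     else if head (graph N) i \<in> asym_junctions N then
       real_of_ereal (min (ereal (realized_demand \<omega> t i (\<rho> $ i)))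
         (let j = the_elem (downstream_cells N i); e = onramp N (head (graph N) i)
          in realized_supply \<omega> t j (\<rho> $ j) - ereal (u $ e)))
     else
       real_of_ereal (min (ereal (realized_demand \<omega> t i (\<rho> $ i)))
         (INF k\<in>downstream_cells N i. realized_supply \<omega> t k (\<rho> $ k) / ereal (split_ratio N k i))))"

definition input_constraints ::
    "('v, 'e::finite) fnc_network \<Rightarrow> 'e realization \<Rightarrow> nat \<Rightarrow> real ^ 'e \<Rightarrow> real ^ 'e \<Rightarrow> bool" where
  "input_constraints N \<omega> t \<rho> \<phi> \<longleftrightarrow>
     (\<forall>e\<in>controlled_cells N. 0 \<le> \<phi> $ e \<and> \<phi> $ e \<le> realized_demand \<omega> t e (\<rho> $ e)) \<and>
     (\<forall>e. tail (graph N) e \<in> controlled_junctions N \<longrightarrow>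
        ereal (\<Sum>i\<in>UNIV. split_ratio N e i * \<phi> $ i) \<le> realized_supply \<omega> t e (\<rho> $ e))"

definition ramp_constraints :: "('v, 'e::finite) fnc_network \<Rightarrow> real ^ 'e \<Rightarrow> bool" where
  "ramp_constraints N \<rho> \<longleftrightarrow> (\<forall>e\<in>source_cells N. \<rho> $ e \<le> ramp_limit N e)"

definition TTS :: "('v, 'e::finite) fnc_network \<Rightarrow> (nat \<Rightarrow> real ^ 'e) \<Rightarrow> real" where
  "TTS N \<rho> = sampling_time N * (\<Sum>t\<le>horizon N. \<Sum>e\<in>UNIV. cell_length N e * \<rho> t $ e)"


section \<open>The deterministic problem\<close>

definition fnc_feasible ::
    "('v, 'e::finite) fnc_network \<Rightarrow> 'e realization \<Rightarrow>
     (nat \<Rightarrow> real ^ 'e) \<Rightarrow> (nat \<Rightarrow> real ^ 'e) \<Rightarrow> bool" where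
  "fnc_feasible N \<omega> \<rho> \<phi> \<longleftrightarrow>
     \<rho> 0 = initial_density N \<and>
     (\<forall>t<horizon N. \<rho> (Suc t) = next_density N (realized_inflow \<omega> t) (\<rho> t) (\<phi> t)) \<and>
     (\<forall>t\<le>horizon N. \<phi> t = flows N \<omega> t (\<rho> t) (\<phi> t) \<and>
        input_constraints N \<omega> t (\<rho> t) (\<phi> t) \<and> ramp_constraints N (\<rho> t))"

definition fnc_optimizer ::
    "('v, 'e::finite) fnc_network \<Rightarrow> 'e realization \<Rightarrow>
     (nat \<Rightarrow> real ^ 'e) \<Rightarrow> (nat \<Rightarrow> real ^ 'e) \<Rightarrow> bool" where
  "fnc_optimizer N \<omega> \<rho> \<phi> \<longleftrightarrow>
     fnc_feasible N \<omega> \<rho> \<phi> \<and> (\<forall>\<rho>' \<phi>'. fnc_feasible N \<omega> \<rho>' \<phi>' \<longrightarrow> TTS N \<rho> \<le> TTS N \<rho>')"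


section \<open>Policies and the robust problem\<close>

text \<open>Only the components of a policy belonging to controlled cells are used.\<close>

type_synonym 'e policy = "nat \<Rightarrow> real ^ 'e \<Rightarrow> real ^ 'e"

definition is_policy :: "('v, 'e::finite) fnc_network \<Rightarrow> 'e policy \<Rightarrow> bool" where
  "is_policy N \<pi> \<longleftrightarrow>
     (\<forall>t\<le>horizon N. \<forall>\<rho>. (\<forall>e. 0 \<le> \<rho> $ e) \<longrightarrow> (\<forall>e\<in>controlled_cells N. 0 \<le> \<pi> t \<rho> $ e))"

primrec closed_loop ::
    "('v, 'e::finite) fnc_network \<Rightarrow> 'e policy \<Rightarrow> 'e realization \<Rightarrow> nat \<Rightarrow> real ^ 'e" where
  "closed_loop N \<pi> \<omega> 0 = initial_density N"
| "closed_loop N \<pi> \<omega> (Suc t) =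
     next_density N (realized_inflow \<omega> t) (closed_loop N \<pi> \<omega> t)
       (flows N \<omega> t (closed_loop N \<pi> \<omega> t) (\<pi> t (closed_loop N \<pi> \<omega> t)))"

definition closed_loop_flows ::
    "('v, 'e::finite) fnc_network \<Rightarrow> 'e policy \<Rightarrow> 'e realization \<Rightarrow> nat \<Rightarrow> real ^ 'e" where
  "closed_loop_flows N \<pi> \<omega> t =
     flows N \<omega> t (closed_loop N \<pi> \<omega> t) (\<pi> t (closed_loop N \<pi> \<omega> t))"

definition feasible_policies :: "('v, 'e::finite) fnc_network \<Rightarrow> 'e policy set" where
  "feasible_policies N = {\<pi>. is_policy N \<pi> \<and>
     (\<forall>\<omega>\<in>uncertainty_set N. \<forall>t\<le>horizon N.
        input_constraints N \<omega> t (closed_loop N \<pi> \<omega> t) (closed_loop_flows N \<pi> \<omega> t) \<and>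
        ramp_constraints N (closed_loop N \<pi> \<omega> t))}"

definition robust_value :: "('v, 'e::finite) fnc_network \<Rightarrow> ereal" where
  "robust_value N =
     (INF \<pi>\<in>feasible_policies N. SUP \<omega>\<in>uncertainty_set N. ereal (TTS N (closed_loop N \<pi> \<omega>)))"

definition asymmetric_assumption :: "('v, 'e::finite) fnc_network \<Rightarrow> bool" where
  "asymmetric_assumption N \<longleftrightarrow>
     (\<forall>v e i j. asymmetric_at N v e i j \<longrightarrow>
        (\<forall>\<omega>\<in>uncertainty_set N. \<forall>\<pi>\<in>feasible_policies N. \<forall>t\<le>horizon N.
           ereal (realized_demand \<omega> t e (closed_loop N \<pi> \<omega> t $ e))
             \<le> realized_supply \<omega> t j (closed_loop N \<pi> \<omega> t $ j)))"

definition fnc_assumptions :: "('v, 'e::finite) fnc_network \<Rightarrow> bool" where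
  "fnc_assumptions N \<longleftrightarrow>
     network_structure N \<and> graph_assumption N \<and> fundamental_diagram N \<and>
     inflow_bounds_ok N \<and> asymmetric_assumption N"


section \<open>The receding horizon policy\<close>

definition reduced_routing :: "('v, 'e::finite) fnc_network \<Rightarrow> real ^ 'e ^ 'e" where
  "reduced_routing N = (\<chi> i j. if j \<in> controlled_cells N then 0 else split_ratio N i j)"

definition P_matrix :: "('v, 'e::finite) fnc_network \<Rightarrow> real ^ 'e ^ 'e" where
  "P_matrix N = matrix_inv (mat 1 - reduced_routing N)"

definition L_matrix :: "('v, 'e::finite) fnc_network \<Rightarrow> real ^ 'e ^ 'e" where
  "L_matrix N = (\<chi> i j. if i = j then cell_length N i else 0)"

definition control_end :: "('v, 'e::finite) fnc_network \<Rightarrow> nat \<Rightarrow> nat \<Rightarrow> nat" where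
  "control_end N Tc t = min (t + Tc) (horizon N)"

text \<open>
  The flow constraints include the last instant \<^term>\<open>control_end N Tc t\<close>, so that the problem
  also determines the controlled flows at the end of the horizon, where \<open>t = control_end N Tc t\<close>.
\<close>

definition mpc_feasible ::
    "('v, 'e::finite) fnc_network \<Rightarrow> nat \<Rightarrow> (nat \<Rightarrow> real ^ 'e) \<Rightarrow> nat \<Rightarrow> real ^ 'e \<Rightarrow>
     (nat \<Rightarrow> real ^ 'e) \<Rightarrow> (nat \<Rightarrow> real ^ 'e) \<Rightarrow> bool" where
  "mpc_feasible N Tc \<rho>opt t x \<rho> \<phi> \<longleftrightarrow>
     \<rho> t = x \<and>
     (\<forall>\<tau>\<in>{t..<control_end N Tc t}.
        \<rho> (Suc \<tau>) = next_density N (inflow_bound N \<tau>) (\<rho> \<tau>) (\<phi> \<tau>)) \<and>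
     (\<forall>\<tau>\<in>{t..control_end N Tc t}.
        ramp_constraints N (\<rho> \<tau>) \<and>
        (\<forall>e. 0 \<le> \<phi> \<tau> $ e \<and> \<phi> \<tau> $ e \<le> demand_lb N e (\<rho> \<tau> $ e)) \<and>
        (\<forall>e. e \<notin> source_cells N \<longrightarrow>
           ereal (\<Sum>i\<in>UNIV. split_ratio N e i * \<phi> \<tau> $ i) \<le> supply_lb N e (\<rho> \<tau> $ e))) \<and>
     (P_matrix N ** L_matrix N) *v (\<rho> (control_end N Tc t) - \<rho>opt (control_end N Tc t)) \<le> 0"

definition mpc_objective ::
    "('v, 'e::finite) fnc_network \<Rightarrow> nat \<Rightarrow> nat \<Rightarrow> (nat \<Rightarrow> real ^ 'e) \<Rightarrow> real" where
  "mpc_objective N Tc t \<rho> =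
     (\<Sum>\<tau>\<in>{t + 1..control_end N Tc t}. \<Sum>e\<in>UNIV. cell_length N e * \<rho> \<tau> $ e)"

definition mpc_minimizer ::
    "('v, 'e::finite) fnc_network \<Rightarrow> nat \<Rightarrow> (nat \<Rightarrow> real ^ 'e) \<Rightarrow> nat \<Rightarrow> real ^ 'e \<Rightarrow>
     (nat \<Rightarrow> real ^ 'e) \<Rightarrow> (nat \<Rightarrow> real ^ 'e) \<Rightarrow> bool" where
  "mpc_minimizer N Tc \<rho>opt t x \<rho> \<phi> \<longleftrightarrow>
     mpc_feasible N Tc \<rho>opt t x \<rho> \<phi> \<and>
     (\<forall>\<rho>' \<phi>'. mpc_feasible N Tc \<rho>opt t x \<rho>' \<phi>' \<longrightarrow>
        mpc_objective N Tc t \<rho> \<le> mpc_objective N Tc t \<rho>')"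

text \<open>
  A receding horizon policy applies some minimizer wherever one exists, and is arbitrary at the
  other states.
\<close>

definition mpc_policy ::
    "('v, 'e::finite) fnc_network \<Rightarrow> nat \<Rightarrow> (nat \<Rightarrow> real ^ 'e) \<Rightarrow> 'e policy \<Rightarrow> bool" where
  "mpc_policy N Tc \<rho>opt \<pi> \<longleftrightarrow>
     is_policy N \<pi> \<and>
     (\<forall>t\<le>horizon N. \<forall>x. (\<exists>\<rho> \<phi>. mpc_minimizer N Tc \<rho>opt t x \<rho> \<phi>) \<longrightarrow>
        (\<exists>\<rho> \<phi>. mpc_minimizer N Tc \<rho>opt t x \<rho> \<phi> \<and>
               (\<forall>e\<in>controlled_cells N. \<pi> t x $ e = \<phi> t $ e)))"

end

theory Submission
  imports Defs
begin

text \<open>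
  Write \<open>L\<close> for the diagonal matrix of cell lengths, \<open>R\<close> for the reduced routing matrix and
  \<open>P = (I - R)\<^sup>-\<^sup>1\<close>, a nonnegative matrix because from every cell some path leads to
  a controlled cell or to a cell where mass leaves the network (\<open>minimum_principle\<close>).  The argument lives in the order
  \<open>P L x \<le> P L x'\<close>, called \<open>no_worse x x'\<close>.  With \<open>\<delta> = P L (x' - x)\<close> it says that
  \<open>L x = L x' - (I - R) \<delta>\<close> for some \<open>\<delta> \<ge> 0\<close>: the state \<open>x\<close> arises from \<open>x'\<close> if each cell \<open>e\<close>
  sends out the additional mass \<open>\<delta> e\<close>, where mass sent out by controlled cells disappears.

  The heart of the proof is a comparison of one time step (\<open>catch_up\<close>, \<open>step_no_worse\<close>).  Let \<open>x\<close> be no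
  worse than \<open>x'\<close> and let \<open>f'\<close> be flows obeying the nominal demand and supply bounds at \<open>x'\<close>.  Control
  \<open>x\<close> by the flows \<open>f'\<close>, cut down to the demand at \<open>x\<close>, and let all other flows be as large as possible.
  Since the CFL condition \<open>\<Delta>t \<gamma> \<le> l\<close> bounds the change of demand and supply caused by the mass \<open>\<delta>\<close>,
  every cell sends out at least \<open>f' - \<delta> / \<Delta>t\<close>, so the new lead is still nonnegative.  This holds for
  every admitted realization, so the actual state is never worse than planned for the worst case.
  The total mass \<open>1\<^sup>T L x\<close> is monotone in the order because the column sums of \<open>R\<close> are at most one,
  and the densities of source cells are monotone because nothing flows into them.  So both the cost
  and the ramp constraints survive the passage to a state that is no worse.

  Feasibility and cost then follow by induction along the closed loop.  At each time there is a
  reference plan up to the end of the horizon: the last online optimizer up to its terminal time,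
  continued by tracking the nominal optimizer \<open>\<rho>\<^sup>*\<close>, which the terminal constraint makes possible.
  Tracking it from the observed state yields a feasible point of the next online problem
  (\<open>nonnegative_plan\<close>), a compactness argument yields a minimizer (\<open>mpc_minimizer_exists\<close>), and the sum
  of the mass already observed and the mass still predicted never increases (\<open>solve_and_apply\<close>).  It
  starts at the cost of \<open>\<rho>\<^sup>*\<close> and ends at the cost of the closed loop.  Finally the cost of \<open>\<rho>\<^sup>*\<close> is
  a lower bound for the robust problem, as any feasible policy, run against the worst case, yields a
  trajectory of the deterministic problem.

  Asymmetric junctions need an extra step.  There the mainline flow is what the supply leaves after
  the onramp flow, and tracking alone does not prevent it from being negative, whereas the online
  problem asks for nonnegative flows.  The assumption that the onramp demand fits into the supply
  helps, but speaks only of trajectories that some feasible policy produces.  Relaxed plans,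
  which may have negative mainline flows, are enough to build such policies, and the observed
  trajectory followed by a tracking trajectory is the closed loop of one of them (\<open>onramp_fits\<close>).
\<close>

section \<open>Auxiliary facts\<close>

lemma lipschitz_onD_abs: "lipschitz_on L S f \<Longrightarrow> x \<in> S \<Longrightarrow> y \<in> S \<Longrightarrow> \<bar>f x - f y\<bar> \<le> L * \<bar>x - y\<bar>"
  for f :: "real \<Rightarrow> real"
  unfolding lipschitz_on_def dist_real_def by blast

text \<open>
  The formula for the mainline flow at an asymmetric junction returns the largest flow that respects
  the demand \<open>d\<close> and the supply \<open>s\<close> reduced by the onramp flow \<open>u\<close>.  Since \<open>u\<close> may exceed \<open>s\<close>,
  this flow may be negative.
\<close>
lemma capped_difference:
  fixes d q u :: real and s :: ereal
  assumes "0 \<le> s" and q: "q = real_of_ereal (min (ereal d) (s - ereal u))"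
  shows "q \<le> d" "ereal (q + u) \<le> s" "c \<le> d \<Longrightarrow> ereal (c + u) \<le> s \<Longrightarrow> c \<le> q"
  using assms by (cases s; auto simp: min_def)+

text \<open>
  The formula for the flow out of a cell that enters no merging junction returns the largest flow that
  respects the demand \<open>d\<close> and the supplies \<open>s k\<close> of all downstream cells.  As \<open>d\<close> is finite, the
  conversion from extended reals is harmless, also for empty \<open>K\<close>.
\<close>
lemma capped_infimum:
  fixes d q :: real and s :: "'k \<Rightarrow> ereal" and b :: "'k \<Rightarrow> real"
  assumes s: "\<And>k. k \<in> K \<Longrightarrow> 0 \<le> s k" and b: "\<And>k. k \<in> K \<Longrightarrow> 0 < b k" and d: "0 \<le> d"
    and q: "q = real_of_ereal (min (ereal d) (INF k\<in>K. s k / ereal (b k)))"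
  shows "q \<le> d" "k \<in> K \<Longrightarrow> ereal (b k * q) \<le> s k"
    "c \<le> d \<Longrightarrow> (\<And>k. k \<in> K \<Longrightarrow> ereal (b k * c) \<le> s k) \<Longrightarrow> c \<le> q"
proof -
  define m where "m = (INF k\<in>K. s k / ereal (b k))"
  have le_m: "ereal c \<le> m \<longleftrightarrow> (\<forall>k\<in>K. ereal (b k * c) \<le> s k)" for c
    using b by (auto simp: m_def le_INF_iff ereal_le_divide_pos)
  have "0 \<le> m" using le_m[of 0] s by (simp add: zero_ereal_def)
  then have "ereal q = min (ereal d) m"
    unfolding q m_def[symmetric] using d by (cases m) (auto simp: min_def)
  then have Q: "ereal c \<le> ereal q \<longleftrightarrow> c \<le> d \<and> (\<forall>k\<in>K. ereal (b k * c) \<le> s k)" for c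
    using le_m[of c] by simp
  show "q \<le> d" "k \<in> K \<Longrightarrow> ereal (b k * q) \<le> s k" using Q[of q] by auto
  show "c \<le> d \<Longrightarrow> (\<And>k. k \<in> K \<Longrightarrow> ereal (b k * c) \<le> s k) \<Longrightarrow> c \<le> q" using Q[of c] by simp
qed

lemma closed_Collect_const_imp: "(p \<Longrightarrow> closed {y. Q y}) \<Longrightarrow> closed {y. p \<longrightarrow> Q y}"
  by (cases p) simp_all

lemma sum_two_phase:
  fixes f g :: "nat \<Rightarrow> real"
  assumes "a \<le> Suc c" "c \<le> T"
  shows "(\<Sum>\<tau>\<in>{a..T}. if \<tau> \<le> c then f \<tau> else g \<tau>) = (\<Sum>\<tau>\<in>{a..c}. f \<tau>) + (\<Sum>\<tau>\<in>{c<..T}. g \<tau>)"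
proof -
  have "{a..T} = {a..c} \<union> {c<..T}" "{a..c} \<inter> {c<..T} = {}" using assms by auto
  then have "(\<Sum>\<tau>\<in>{a..T}. if \<tau> \<le> c then f \<tau> else g \<tau>) =
      (\<Sum>\<tau>\<in>{a..c}. if \<tau> \<le> c then f \<tau> else g \<tau>) + (\<Sum>\<tau>\<in>{c<..T}. if \<tau> \<le> c then f \<tau> else g \<tau>)"
    by (simp add: sum.union_disjoint)
  also have "(\<Sum>\<tau>\<in>{a..c}. if \<tau> \<le> c then f \<tau> else g \<tau>) = (\<Sum>\<tau>\<in>{a..c}. f \<tau>)" by (intro sum.cong) auto
  also have "(\<Sum>\<tau>\<in>{c<..T}. if \<tau> \<le> c then f \<tau> else g \<tau>) = (\<Sum>\<tau>\<in>{c<..T}. g \<tau>)" by (intro sum.cong) auto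
  finally show ?thesis .
qed

section \<open>Structure of the network\<close>

locale traffic_network =
  fixes N :: "('v, 'e::finite) fnc_network"
  assumes wellformed: "network_structure N"
    and assumed_graph: "graph_assumption N"
    and diagram: "fundamental_diagram N"
    and inflow: "inflow_bounds_ok N"
begin

abbreviation C :: "'e set" where "C \<equiv> controlled_cells N"
abbreviation \<beta> :: "'e \<Rightarrow> 'e \<Rightarrow> real" where "\<beta> \<equiv> split_ratio N"
abbreviation len :: "'e \<Rightarrow> real" where "len \<equiv> cell_length N"
abbreviation dt :: real where "dt \<equiv> sampling_time N"
abbreviation hd_of :: "'e \<Rightarrow> 'v" where "hd_of \<equiv> head (graph N)"
abbreviation tl_of :: "'e \<Rightarrow> 'v" where "tl_of \<equiv> tail (graph N)"
abbreviation inflow_to :: "'e \<Rightarrow> real ^ 'e \<Rightarrow> real" where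
  "inflow_to e f \<equiv> (\<Sum>i\<in>UNIV. \<beta> e i * f $ i)"

lemma len_pos [simp]: "len e > 0"
  and dt_pos [simp]: "dt > 0"
  and col_sum_le_1: "(\<Sum>i\<in>UNIV. \<beta> i e) \<le> 1"
  using wellformed by (auto simp: network_structure_def)

lemma dt_nonneg [simp]: "0 \<le> dt" and len_nonneg [simp]: "0 \<le> len e"
  by (simp_all add: less_imp_le)

lemma len_mult_nonneg_iff: "0 \<le> len e * r \<longleftrightarrow> 0 \<le> r"
  using mult_le_cancel_left_pos[OF len_pos[of e], of 0 r] by simp

lemma beta_pos_iff: "0 < \<beta> e i \<longleftrightarrow> tl_of e = hd_of i"
  and beta_nonzero_iff: "\<beta> e i \<noteq> 0 \<longleftrightarrow> tl_of e = hd_of i"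
  and beta_nonneg [simp]: "0 \<le> \<beta> e i"
proof -
  have "if tl_of e = hd_of i then \<beta> e i > 0 else \<beta> e i = 0"
    using wellformed by (auto simp: network_structure_def)
  then show "0 < \<beta> e i \<longleftrightarrow> tl_of e = hd_of i" "\<beta> e i \<noteq> 0 \<longleftrightarrow> tl_of e = hd_of i" "0 \<le> \<beta> e i"
    by (auto split: if_splits)
qed

lemma in_arcs_eq: "in_arcs (graph N) v = {e. hd_of e = v}"
  and out_arcs_eq: "out_arcs (graph N) v = {e. tl_of e = v}"
  using wellformed by (auto simp: network_structure_def in_arcs_def out_arcs_def)

lemma in_degree_eq: "in_degree (graph N) v = card {e. hd_of e = v}"
  by (simp add: in_degree_def in_arcs_eq)

lemma head_in_verts: "hd_of e \<in> verts (graph N)"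
  using wellformed by (auto simp: network_structure_def fin_digraph_def wf_digraph_def)

lemma source_iff: "e \<in> source_cells N \<longleftrightarrow> (\<forall>i. \<beta> e i = 0)"
proof -
  have "e \<in> source_cells N \<longleftrightarrow> (\<forall>i. hd_of i \<noteq> tl_of e)"
    by (auto simp: source_cells_def in_degree_eq)
  then show ?thesis using beta_nonzero_iff[of e] by metis
qed

lemma inflow_to_source: "e \<in> source_cells N \<Longrightarrow> inflow_to e f = 0"
  by (simp add: source_iff)

lemma asymmetric_exists: "v \<in> asym_junctions N \<Longrightarrow> \<exists>e i j. asymmetric_at N v e i j"
  using wellformed by (auto simp: network_structure_def)

lemma head_onramp: "v \<in> asym_junctions N \<Longrightarrow> hd_of (onramp N v) = v"
proof -
  assume "v \<in> asym_junctions N"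
  then obtain e i j where "asymmetric_at N v e i j" using asymmetric_exists by blast
  then have "onramp N v \<in> in_arcs (graph N) v" unfolding asymmetric_at_def by blast
  then show ?thesis by simp
qed

lemma onramp_controlled: "v \<in> asym_junctions N \<Longrightarrow> onramp N v \<in> C"
  by (auto simp: controlled_cells_def)

lemma controlled_iff:
  "e \<in> C \<longleftrightarrow> hd_of e \<in> controlled_junctions N \<or> hd_of e \<in> asym_junctions N \<and> e = onramp N (hd_of e)"
  by (auto simp: controlled_cells_def head_onramp)

text \<open>
  The head of a cell that is neither controlled nor enters an asymmetric junction is no merging
  junction, hence the downstream cells of such a cell have no other inflow.
\<close>
lemma sole_inflow:
  assumes "i \<notin> C" "hd_of i \<notin> asym_junctions N" "tl_of e = hd_of i"
  shows "inflow_to e f = \<beta> e i * f $ i"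
proof -
  have "hd_of i \<notin> merging_junctions N"
    using assms by (auto simp: controlled_iff controlled_junctions_def)
  then have "card {k. hd_of k = hd_of i} \<le> 1"
    using head_in_verts by (auto simp: merging_junctions_def in_degree_eq)
  then have uniq: "k = i" if "hd_of k = hd_of i" for k
    using that card_le_Suc0_iff_eq[of "{k. hd_of k = hd_of i}"] by simp
  have "\<beta> e k = 0" if "k \<noteq> i" for k
    using beta_nonzero_iff[of e k] assms(3) uniq[of k] that by metis
  then have "inflow_to e f = (\<Sum>k\<in>{i}. \<beta> e k * f $ k)"
    by (intro sum.mono_neutral_right) auto
  then show ?thesis by simp
qed

lemma asymmetric_junction:
  assumes "asymmetric_at N v a i j"
  shows "inflow_to j f = f $ a + f $ i" "tl_of j = v" "hd_of a = v" "hd_of i = v"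
    "a \<in> C" "i \<notin> C" "a = onramp N v" "v \<in> asym_junctions N" "downstream_cells N i = {j}"
    "\<beta> j i = 1"
proof -
  from assms have D: "v \<in> asym_junctions N" "a = onramp N v" "a \<noteq> i"
    "{e. hd_of e = v} = {a, i}" "{e. tl_of e = v} = {j}" "\<beta> j a = 1" "\<beta> j i = 1"
    unfolding asymmetric_at_def in_arcs_eq out_arcs_eq by - (elim conjE, assumption)+
  show T: "tl_of j = v" "hd_of a = v" "hd_of i = v"
    using eqset_imp_iff[OF D(5), of j] eqset_imp_iff[OF D(4), of a] eqset_imp_iff[OF D(4), of i] by simp_all
  show "a = onramp N v" "v \<in> asym_junctions N" "\<beta> j i = 1" by fact+
  show "a \<in> C" using D(1) unfolding D(2) by (rule onramp_controlled)
  have "i \<noteq> onramp N (hd_of i)" "hd_of i \<notin> controlled_junctions N"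
    unfolding T(3) using D(1-3) by (blast, simp add: controlled_junctions_def)
  then show "i \<notin> C" using controlled_iff by blast
  show "downstream_cells N i = {j}"
    unfolding downstream_cells_def out_arcs_eq T(3) by (rule D(5))
  have "\<beta> j k = 0" if "k \<notin> {a, i}" for k
    using eqset_imp_iff[OF D(4), of k] T(1) beta_nonzero_iff[of j k] that by simp
  then have "inflow_to j f = (\<Sum>k\<in>{a, i}. \<beta> j k * f $ k)"
    by (intro sum.mono_neutral_right) auto
  also have "\<dots> = f $ a + f $ i" using D(3,6,7) by simp
  finally show "inflow_to j f = f $ a + f $ i" .
qed

lemma mainline_asymmetric:
  assumes "i \<notin> C" "hd_of i \<in> asym_junctions N"
  obtains j where "asymmetric_at N (hd_of i) (onramp N (hd_of i)) i j"
proof -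
  obtain a k j where A: "asymmetric_at N (hd_of i) a k j" using asymmetric_exists assms by blast
  then have "in_arcs (graph N) (hd_of i) = {a, k}" by (simp only: asymmetric_at_def)
  moreover have "i \<in> in_arcs (graph N) (hd_of i)" by (simp add: in_arcs_eq)
  ultimately have "i \<in> {a, k}" by (simp only:)
  then have "i = k" using asymmetric_junction(5)[OF A] assms by blast
  then show thesis using that[of j] A asymmetric_junction(7)[OF A] by simp
qed

text \<open>
  Inflow bounds are proved cell by cell, according to the kind of junction at the tail of the cell.
\<close>
lemma cell_cases:
  obtains (source) "e \<in> source_cells N"
  | (controlled) "tl_of e \<in> controlled_junctions N" "\<And>i. \<beta> e i \<noteq> 0 \<Longrightarrow> i \<in> C"
  | (asymmetric) a i where "asymmetric_at N (tl_of e) a i e"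
  | (single) i where "i \<notin> C" "hd_of i \<notin> asym_junctions N" "tl_of e = hd_of i"
proof -
  consider "e \<in> source_cells N" | "tl_of e \<in> controlled_junctions N"
    | "tl_of e \<in> asym_junctions N"
    | "e \<notin> source_cells N" "tl_of e \<notin> controlled_junctions N" "tl_of e \<notin> asym_junctions N"
    by blast
  then show thesis
  proof cases
    case 1 then show ?thesis by (rule source)
  next
    case 2
    then show ?thesis using beta_nonzero_iff[of e] controlled_iff by (intro controlled) metis+
  next
    case 3
    then obtain a i j where A: "asymmetric_at N (tl_of e) a i j" using asymmetric_exists by blast
    then have "out_arcs (graph N) (tl_of e) = {j}" by (simp only: asymmetric_at_def)
    moreover have "e \<in> out_arcs (graph N) (tl_of e)" by (simp add: out_arcs_eq)
    ultimately have "e = j" by (simp only: singleton_iff)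
    with A show ?thesis by (intro asymmetric) auto
  next
    case 4
    then obtain i where i: "tl_of e = hd_of i" using source_iff beta_nonzero_iff by blast
    then have "i \<notin> C" "hd_of i \<notin> asym_junctions N" using 4 controlled_iff[of i] by simp_all
    then show ?thesis using i by (rule single)
  qed
qed

section \<open>Nominal demand and supply\<close>

lemma lip_nonneg: "0 \<le> lip N"
  using diagram by (auto simp: fundamental_diagram_def lipschitz_on_def)

lemma dt_lip: "dt * lip N \<le> len e"
  using diagram by (auto simp: fundamental_diagram_def)

lemma jam_nonneg: "0 \<le> jam_density N e"
proof -
  have "0 \<le> initial_density N $ e" "ereal (initial_density N $ e) \<le> jam_density N e"
    using diagram by (auto simp: fundamental_diagram_def density_range_def)
  then show ?thesis by (metis ereal_less_eq(5) order_trans)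
qed

lemma source_supply: "e \<in> source_cells N \<Longrightarrow> supply_lb N e x = \<infinity>"
  using diagram by (auto simp: fundamental_diagram_def supply_lb_def)

text \<open>
  Composed with this projection to the range of admissible densities, the nominal functions become
  the extensions \<^const>\<open>demand_lb\<close> and, for finite capacity, \<^const>\<open>supply_lb\<close>.  On nonnegative
  densities it is monotone and does not increase distances, so the extensions inherit monotonicity
  and the Lipschitz constant.
\<close>
definition clip :: "'e \<Rightarrow> real \<Rightarrow> real" where
  "clip e x = (if ereal x \<le> jam_density N e then x else real_of_ereal (jam_density N e))"

lemma clip_range: "0 \<le> x \<Longrightarrow> clip e x \<in> density_range N e"
  using jam_nonneg[of e] by (cases "jam_density N e") (auto simp: clip_def density_range_def)

lemma clip_diff: "0 \<le> x \<Longrightarrow> x \<le> y \<Longrightarrow> clip e x \<le> clip e y \<and> clip e y - clip e x \<le> y - x"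
  using jam_nonneg[of e] by (cases "jam_density N e") (auto simp: clip_def)

lemma demand_lb_clip: "demand_lb N e x = nominal_demand N e (clip e x)"
  by (simp add: demand_lb_def clip_def)

lemma supply_lb_clip:
  "0 \<le> x \<Longrightarrow> jam_density N e \<noteq> \<infinity> \<Longrightarrow> supply_lb N e x = ereal (nominal_supply N e (clip e x))"
  using diagram by (auto simp: fundamental_diagram_def supply_lb_def clip_def)

lemma nominal_demand_facts:
  "x \<in> density_range N e \<Longrightarrow> 0 \<le> nominal_demand N e x"
  "x \<in> density_range N e \<Longrightarrow> y \<in> density_range N e \<Longrightarrow>
    \<bar>nominal_demand N e x - nominal_demand N e y\<bar> \<le> lip N * \<bar>x - y\<bar>"
  "x \<in> density_range N e \<Longrightarrow> y \<in> density_range N e \<Longrightarrow> x \<le> y \<Longrightarrow>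
    nominal_demand N e x \<le> nominal_demand N e y"
  "nominal_demand N e 0 = 0"
  using diagram unfolding fundamental_diagram_def
  by (blast, blast intro: lipschitz_onD_abs, blast dest: mono_onD, blast)

lemma nominal_supply_facts:
  assumes "jam_density N e \<noteq> \<infinity>"
  shows
  "x \<in> density_range N e \<Longrightarrow> 0 \<le> nominal_supply N e x"
  "x \<in> density_range N e \<Longrightarrow> y \<in> density_range N e \<Longrightarrow>
    \<bar>nominal_supply N e x - nominal_supply N e y\<bar> \<le> lip N * \<bar>x - y\<bar>"
  "x \<in> density_range N e \<Longrightarrow> y \<in> density_range N e \<Longrightarrow> x \<le> y \<Longrightarrow>
    nominal_supply N e y \<le> nominal_supply N e x"
  using diagram assms unfolding fundamental_diagram_def
  by (blast, blast intro: lipschitz_onD_abs, meson monotone_onD)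

lemma demand_lb_nonneg: "0 \<le> x \<Longrightarrow> 0 \<le> demand_lb N e x"
  by (simp add: demand_lb_clip nominal_demand_facts clip_range)

lemma demand_lb_mono: "0 \<le> x \<Longrightarrow> x \<le> y \<Longrightarrow> demand_lb N e x \<le> demand_lb N e y"
  by (simp add: demand_lb_clip nominal_demand_facts clip_range clip_diff)

lemma demand_lb_diff:
  assumes "0 \<le> x" "x \<le> y"
  shows "demand_lb N e y - demand_lb N e x \<le> lip N * (y - x)"
proof -
  have "demand_lb N e y - demand_lb N e x \<le> lip N * \<bar>clip e y - clip e x\<bar>"
    using nominal_demand_facts(2)[of "clip e y" e "clip e x"] clip_range assms
    by (force simp: demand_lb_clip)
  also have "\<dots> \<le> lip N * (y - x)"
    using clip_diff[OF assms] lip_nonneg by (intro mult_left_mono) auto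
  finally show ?thesis .
qed

lemma demand_lb_le_lip: "0 \<le> x \<Longrightarrow> demand_lb N e x \<le> lip N * x"
  using demand_lb_diff[of 0 x e] jam_nonneg[of e] nominal_demand_facts(4)[of e]
  by (simp add: demand_lb_def zero_ereal_def)

lemma supply_lb_nonneg: "0 \<le> x \<Longrightarrow> 0 \<le> supply_lb N e x"
  by (cases "jam_density N e = \<infinity>")
    (auto simp: supply_lb_clip nominal_supply_facts clip_range, simp add: supply_lb_def)

lemma supply_lb_antimono: "0 \<le> x \<Longrightarrow> x \<le> y \<Longrightarrow> supply_lb N e y \<le> supply_lb N e x"
  by (cases "jam_density N e = \<infinity>")
    (auto simp: supply_lb_clip nominal_supply_facts clip_range clip_diff, simp add: supply_lb_def)

lemma supply_lb_diff:
  assumes "0 \<le> x" "x \<le> y"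
  shows "supply_lb N e x \<le> supply_lb N e y + ereal (lip N * (y - x))"
proof (cases "jam_density N e = \<infinity>")
  case True then show ?thesis by (simp add: supply_lb_def)
next
  case False
  have "nominal_supply N e (clip e x) - nominal_supply N e (clip e y) \<le> lip N * \<bar>clip e x - clip e y\<bar>"
    using nominal_supply_facts(2)[OF False, of "clip e x" "clip e y"] clip_range assms by force
  also have "\<dots> \<le> lip N * (y - x)"
    using clip_diff[OF assms] lip_nonneg by (intro mult_left_mono) auto
  finally show ?thesis using False assms by (simp add: supply_lb_clip)
qed

lemma worst_case_simps [simp]:
  "realized_inflow (worst_case N) = inflow_bound N"
  "realized_demand (worst_case N) t = demand_lb N"
  "realized_supply (worst_case N) t = supply_lb N"
  by (simp_all add: worst_case_def)

lemma worst_case_uncertain: "worst_case N \<in> uncertainty_set N"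
  using inflow demand_lb_nonneg demand_lb_le_lip supply_lb_nonneg
  by (auto simp: worst_case_def uncertainty_set_def inflow_bounds_ok_def supply_lb_def)

section \<open>The order on states\<close>

abbreviation R where "R \<equiv> reduced_routing N"

lemma R_nonneg: "0 \<le> R $ i $ j"
  by (simp add: reduced_routing_def)

lemma R_col_sum: "(\<Sum>i\<in>UNIV. R $ i $ j) \<le> 1"
  using col_sum_le_1[of j] by (cases "j \<in> C") (simp_all add: reduced_routing_def)

text \<open>
  If \<open>y\<close> had a negative minimum, then at any cell \<open>n\<close> attaining it the weighted sum over the successors
  of \<open>n\<close> can stay below the minimum only if the column sum at \<open>n\<close> is one and all successors attain
  the minimum too.  So \<open>n\<close> is not controlled, and following a path to a cell with column sum below one
  gives a contradiction.
\<close>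
lemma minimum_principle:
  fixes y :: "real ^ 'e"
  assumes y: "\<And>j. (\<Sum>i\<in>UNIV. R $ i $ j * y $ i) \<le> y $ j"
  shows "0 \<le> y $ j"
proof (rule ccontr)
  assume neg: "\<not> 0 \<le> y $ j"
  define m where "m = Min (range (($) y))"
  have m_le: "m \<le> y $ i" for i unfolding m_def by (intro Min_le) auto
  have "m \<in> range (($) y)" unfolding m_def by (intro Min_in) auto
  then obtain k where k: "y $ k = m" by auto
  have m: "m < 0" using m_le[of j] neg by simp
  have tight: "(\<Sum>i\<in>UNIV. R $ i $ n) = 1 \<and> (\<forall>i. R $ i $ n \<noteq> 0 \<longrightarrow> y $ i = m)" if "y $ n = m" for n
  proof -
    have "(\<Sum>i\<in>UNIV. R $ i $ n * (y $ i - m)) + m * (\<Sum>i\<in>UNIV. R $ i $ n) \<le> m"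
      using y[of n] that by (simp add: algebra_simps sum.distrib sum_subtractf sum_distrib_left)
    moreover have "0 \<le> (\<Sum>i\<in>UNIV. R $ i $ n * (y $ i - m))"
      using R_nonneg m_le by (intro sum_nonneg) auto
    moreover have "m \<le> m * (\<Sum>i\<in>UNIV. R $ i $ n)"
      using mult_left_mono_neg[OF R_col_sum[of n], of m] m by simp
    ultimately have Z: "(\<Sum>i\<in>UNIV. R $ i $ n * (y $ i - m)) = 0" "m * (\<Sum>i\<in>UNIV. R $ i $ n) = m"
      by linarith+
    from Z(1) have "R $ i $ n * (y $ i - m) = 0" for i
      using R_nonneg m_le by (subst (asm) sum_nonneg_eq_0_iff) auto
    then show ?thesis using Z(2) m by auto
  qed
  have unc: "R $ i $ n = \<beta> i n" if "y $ n = m" for i n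
  proof -
    have "n \<notin> C" using tight[OF that] by (auto simp: reduced_routing_def)
    then show ?thesis by (simp add: reduced_routing_def)
  qed
  from assumed_graph obtain e where e: "(k, e) \<in> {(i, k). \<beta> k i \<noteq> 0}\<^sup>*" "(\<Sum>i\<in>UNIV. \<beta> i e) < 1"
    unfolding graph_assumption_def by blast
  from e(1) have "y $ e = m"
  proof (induction rule: rtrancl_induct)
    case base then show ?case by (rule k)
  next
    case (step n n')
    then show ?case using tight[of n] unc[of n n'] by auto
  qed
  then show False using tight[of e] unc[of e] e(2) by simp
qed

abbreviation P where "P \<equiv> P_matrix N"

text \<open>
  The minimum principle, applied to \<open>y\<close> and \<open>- y\<close>, makes the kernel of the transposed matrix trivial.
\<close>
lemma invertible: "invertible (mat 1 - R)"
proof -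
  have "y = 0" if "transpose (mat 1 - R) *v y = 0" for y
  proof -
    have eq: "y $ j = (\<Sum>i\<in>UNIV. R $ i $ j * y $ i)" for j
    proof -
      have "0 = (transpose (mat 1 - R) *v y) $ j" using that by simp
      also have "\<dots> = (\<Sum>i\<in>UNIV. ((if i = j then y $ i else 0) - R $ i $ j * y $ i))"
        unfolding matrix_vector_mult_def transpose_def mat_def
        by (auto intro!: sum.cong simp: algebra_simps)
      finally show ?thesis by (simp add: sum_subtractf)
    qed
    have "0 \<le> y $ j" "0 \<le> (- y) $ j" for j
      by (rule minimum_principle, simp add: sum_negf eq[symmetric])+
    then show ?thesis by (metis vec_eq_iff zero_index antisym neg_0_le_iff_le vector_uminus_component)
  qed
  then have "invertible (transpose (mat 1 - R))"
    by (simp add: invertible_left_inverse matrix_left_invertible_ker)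
  then show ?thesis using transpose_invertible by fastforce
qed

lemma P_left: "P ** (mat 1 - R) = mat 1" and P_right: "(mat 1 - R) ** P = mat 1"
  using someI_ex[OF invertible[unfolded invertible_def]]
  by (auto simp: P_matrix_def matrix_inv_def)

text \<open>
  Each row of \<open>P\<close> satisfies the hypothesis of the minimum principle.
\<close>
lemma P_nonneg: "0 \<le> P $ k $ j"
proof -
  define y where "y = row k P"
  have "(\<Sum>i\<in>UNIV. R $ i $ j * y $ i) = y $ j - (if k = j then 1 else 0)" for j
  proof -
    have "(P ** (mat 1 - R)) $ k $ j = (if k = j then 1 else 0)"
      unfolding P_left by (simp add: mat_def)
    moreover have "(P ** (mat 1 - R)) $ k $ j = (\<Sum>i\<in>UNIV. ((if i = j then y $ i else 0) - R $ i $ j * y $ i))"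
      unfolding matrix_matrix_mult_def mat_def y_def row_def
      by (auto intro!: sum.cong simp: algebra_simps)
    ultimately show ?thesis by (simp add: sum_subtractf)
  qed
  then have "0 \<le> y $ j" by (intro minimum_principle) auto
  then show ?thesis by (simp add: y_def row_def)
qed

text \<open>
  The terminal constraint of the online problem, as a preorder on states.
\<close>
definition no_worse :: "real ^ 'e \<Rightarrow> real ^ 'e \<Rightarrow> bool" where
  "no_worse x x' \<longleftrightarrow> (P ** L_matrix N) *v (x - x') \<le> 0"

text \<open>
  The amount of mass by which each cell of \<open>x\<close> is ahead of the same cell of \<open>x'\<close>; see the lemma
  \<open>lead_eq\<close>.
\<close>
definition lead :: "real ^ 'e \<Rightarrow> real ^ 'e \<Rightarrow> real ^ 'e" where
  "lead x x' = (P ** L_matrix N) *v (x' - x)"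

lemma no_worse_lead: "no_worse x x' \<longleftrightarrow> (\<forall>e. 0 \<le> lead x x' $ e)"
proof -
  have "lead x x' = - ((P ** L_matrix N) *v (x - x'))"
    unfolding lead_def by (simp add: matrix_vector_mult_diff_distrib)
  then show ?thesis by (simp add: no_worse_def less_eq_vec_def)
qed

lemma L_matrix_apply: "(L_matrix N *v x) $ e = len e * x $ e"
  by (simp add: matrix_vector_mult_def L_matrix_def if_distrib[of "\<lambda>u. u * _"] cong: if_cong)

lemma I_minus_R_apply: "((mat 1 - R) *v d) $ e = d $ e - (\<Sum>i\<in>UNIV. R $ e $ i * d $ i)"
proof -
  have "((mat 1 - R) *v d) $ e = (\<Sum>i\<in>UNIV. ((if i = e then d $ i else 0) - R $ e $ i * d $ i))"
    unfolding matrix_vector_mult_def mat_def by (auto intro!: sum.cong simp: algebra_simps)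
  then show ?thesis by (simp add: sum_subtractf)
qed

lemma lead_eq: "len e * (x' $ e - x $ e) = lead x x' $ e - (\<Sum>i\<in>UNIV. R $ e $ i * lead x x' $ i)"
proof -
  have "(mat 1 - R) *v lead x x' = L_matrix N *v (x' - x)"
    unfolding lead_def by (simp add: matrix_vector_mul_assoc matrix_mul_assoc P_right)
  then show ?thesis
    using I_minus_R_apply[of "lead x x'" e] L_matrix_apply[of "x' - x" e] by simp
qed

text \<open>
  It is enough to exhibit a nonnegative lead \<open>d\<close> up to a nonnegative surplus \<open>b\<close> of mass
  in \<open>x'\<close>, because \<open>P\<close> maps the surplus to the nonnegative lead \<open>P b\<close>.
\<close>
lemma no_worseI:
  assumes eq: "\<And>e. b $ e + d $ e - (\<Sum>i\<in>UNIV. R $ e $ i * d $ i) = len e * (x' $ e - x $ e)"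
    and b: "\<And>e. 0 \<le> b $ e" and d: "\<And>e. 0 \<le> d $ e"
  shows "no_worse x x'"
proof -
  have "L_matrix N *v (x' - x) = b + (mat 1 - R) *v d"
    by (simp add: vec_eq_iff I_minus_R_apply L_matrix_apply eq[symmetric])
  then have "lead x x' = P *v b + (P ** (mat 1 - R)) *v d"
    unfolding lead_def matrix_vector_mul_assoc[symmetric]
    by (simp add: matrix_vector_right_distrib)
  then have "lead x x' = P *v b + d" by (simp add: P_left)
  moreover have "0 \<le> (P *v b) $ e" for e
    using P_nonneg b by (auto simp: matrix_vector_mult_def intro!: sum_nonneg)
  ultimately show ?thesis using d by (simp add: no_worse_lead)
qed

lemma no_worse_refl: "no_worse x x"
  by (simp add: no_worse_def)

lemma no_worse_trans: "no_worse x y \<Longrightarrow> no_worse y z \<Longrightarrow> no_worse x z"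
proof -
  have "lead x z = lead x y + lead y z"
    unfolding lead_def by (simp add: matrix_vector_mult_diff_distrib)
  then show "no_worse x y \<Longrightarrow> no_worse y z \<Longrightarrow> no_worse x z"
    by (simp add: no_worse_lead)
qed

definition mass :: "real ^ 'e \<Rightarrow> real" where
  "mass x = (\<Sum>e\<in>UNIV. len e * x $ e)"

text \<open>
  The total mass is \<open>1\<^sup>T (I - R) P L x\<close>, and \<open>1\<^sup>T (I - R) \<ge> 0\<close> by the bound on the column sums.
\<close>
lemma no_worse_mass:
  assumes "no_worse x x'" shows "mass x \<le> mass x'"
proof -
  define d where "d = lead x x'"
  have "mass x' - mass x = (\<Sum>e\<in>UNIV. len e * (x' $ e - x $ e))"
    by (simp add: mass_def algebra_simps sum_subtractf)
  also have "\<dots> = (\<Sum>e\<in>UNIV. d $ e) - (\<Sum>e\<in>UNIV. \<Sum>i\<in>UNIV. R $ e $ i * d $ i)"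
    by (simp add: lead_eq d_def sum_subtractf)
  also have "(\<Sum>e\<in>UNIV. \<Sum>i\<in>UNIV. R $ e $ i * d $ i) = (\<Sum>i\<in>UNIV. (\<Sum>e\<in>UNIV. R $ e $ i) * d $ i)"
    by (subst sum.swap) (simp add: sum_distrib_right)
  also have "\<dots> \<le> (\<Sum>i\<in>UNIV. d $ i)"
    using R_col_sum assms by (intro sum_mono mult_left_le_one_le)
      (auto simp: no_worse_lead d_def intro!: sum_nonneg R_nonneg)
  finally (xtrans) show ?thesis by simp
qed

section \<open>Flows are maximal\<close>

lemma flows_controlled: "i \<in> C \<Longrightarrow> flows N \<omega> t x u $ i = u $ i"
  by (simp add: flows_def)

text \<open>
  By the CFL condition \<open>\<Delta>t \<gamma> \<le> l\<close> a cell cannot send out more mass in one step than it contains.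
\<close>
lemma density_stays_nonneg:
  assumes "0 \<le> x $ e" "0 \<le> inflow_to e f" "f $ e \<le> lip N * x $ e" "0 \<le> w e"
  shows "0 \<le> next_density N w x f $ e"
proof -
  have "dt * f $ e \<le> dt * (lip N * x $ e)"
    using assms by (intro mult_left_mono) auto
  also have "\<dots> \<le> len e * x $ e"
    using mult_right_mono[OF dt_lip assms(1)] by (simp add: mult.assoc)
  finally have "dt / len e * f $ e \<le> x $ e"
    by (simp add: field_simps)
  moreover have "0 \<le> dt / len e * (inflow_to e f + w e)"
    using assms by (intro mult_nonneg_nonneg add_nonneg_nonneg) auto
  ultimately show ?thesis by (simp add: next_density_def algebra_simps)
qed

lemma uncertainD:
  assumes "\<omega> \<in> uncertainty_set N" "t \<le> horizon N"
  shows "0 \<le> realized_inflow \<omega> t e" "realized_inflow \<omega> t e \<le> inflow_bound N t e"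
    "0 \<le> r \<Longrightarrow> 0 \<le> realized_demand \<omega> t e r" "0 \<le> r \<Longrightarrow> demand_lb N e r \<le> realized_demand \<omega> t e r"
    "0 \<le> r \<Longrightarrow> realized_demand \<omega> t e r \<le> lip N * r"
    "0 \<le> r \<Longrightarrow> 0 \<le> realized_supply \<omega> t e r" "0 \<le> r \<Longrightarrow> supply_lb N e r \<le> realized_supply \<omega> t e r"
  using assms unfolding uncertainty_set_def by blast+

context
  fixes \<omega> :: "'e realization" and t :: nat and x :: "real ^ 'e"
  assumes uncertain: "\<omega> \<in> uncertainty_set N" "t \<le> horizon N" and x_nonneg: "\<And>e. 0 \<le> x $ e"
begin

abbreviation demand_at :: "'e \<Rightarrow> real" where "demand_at e \<equiv> realized_demand \<omega> t e (x $ e)"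
abbreviation supply_at :: "'e \<Rightarrow> ereal" where "supply_at e \<equiv> realized_supply \<omega> t e (x $ e)"

lemma realized: "0 \<le> realized_inflow \<omega> t e" "realized_inflow \<omega> t e \<le> inflow_bound N t e"
    "0 \<le> realized_demand \<omega> t e (x $ e)" "demand_lb N e (x $ e) \<le> realized_demand \<omega> t e (x $ e)"
    "realized_demand \<omega> t e (x $ e) \<le> lip N * x $ e"
    "0 \<le> realized_supply \<omega> t e (x $ e)" "supply_lb N e (x $ e) \<le> realized_supply \<omega> t e (x $ e)"
  using uncertainD[OF uncertain] x_nonneg by simp_all

lemma mainline_flow:
  assumes A: "asymmetric_at N v a i j"
  shows "flows N \<omega> t x u $ i \<le> demand_at i" "ereal (flows N \<omega> t x u $ i + u $ a) \<le> supply_at j"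
    "c \<le> demand_at i \<Longrightarrow> ereal (c + u $ a) \<le> supply_at j \<Longrightarrow> c \<le> flows N \<omega> t x u $ i"
proof -
  have "flows N \<omega> t x u $ i = real_of_ereal (min (ereal (demand_at i)) (supply_at j - ereal (u $ a)))"
    using asymmetric_junction(3-9)[OF A] by (simp add: flows_def)
  note capped_difference[OF realized(6) this]
  then show "flows N \<omega> t x u $ i \<le> demand_at i" "ereal (flows N \<omega> t x u $ i + u $ a) \<le> supply_at j"
    "c \<le> demand_at i \<Longrightarrow> ereal (c + u $ a) \<le> supply_at j \<Longrightarrow> c \<le> flows N \<omega> t x u $ i"
    by blast+
qed

lemma single_flow:
  assumes i: "i \<notin> C" "hd_of i \<notin> asym_junctions N"
  shows "flows N \<omega> t x u $ i \<le> demand_at i"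
    "tl_of k = hd_of i \<Longrightarrow> ereal (\<beta> k i * flows N \<omega> t x u $ i) \<le> supply_at k"
    "c \<le> demand_at i \<Longrightarrow> (\<And>k. tl_of k = hd_of i \<Longrightarrow> ereal (\<beta> k i * c) \<le> supply_at k) \<Longrightarrow>
      c \<le> flows N \<omega> t x u $ i"
proof -
  have D: "k \<in> downstream_cells N i \<longleftrightarrow> tl_of k = hd_of i" for k
    by (simp add: downstream_cells_def out_arcs_eq)
  have "flows N \<omega> t x u $ i = real_of_ereal (min (ereal (demand_at i))
      (INF k\<in>downstream_cells N i. supply_at k / ereal (\<beta> k i)))"
    using i by (simp add: flows_def)
  note capped_infimum[OF realized(6) _ realized(3) this]
  then show "flows N \<omega> t x u $ i \<le> demand_at i"
    "tl_of k = hd_of i \<Longrightarrow> ereal (\<beta> k i * flows N \<omega> t x u $ i) \<le> supply_at k"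
    "c \<le> demand_at i \<Longrightarrow> (\<And>k. tl_of k = hd_of i \<Longrightarrow> ereal (\<beta> k i * c) \<le> supply_at k) \<Longrightarrow>
      c \<le> flows N \<omega> t x u $ i"
    using beta_pos_iff unfolding D by blast+
qed

context
  fixes u :: "real ^ 'e"
  assumes u: "\<And>e. e \<in> C \<Longrightarrow> 0 \<le> u $ e" "\<And>e. e \<in> C \<Longrightarrow> u $ e \<le> demand_at e"
begin

abbreviation flow :: "real ^ 'e" where "flow \<equiv> flows N \<omega> t x u"

lemma flow_le_demand: "flow $ e \<le> demand_at e"
proof (cases "e \<in> C")
  case True then show ?thesis by (simp add: flows_controlled u)
next
  case False
  then show ?thesis
    using mainline_asymmetric[of e] mainline_flow(1) single_flow(1) by metis
qed

lemma inflow_le_supply: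
  assumes "tl_of e \<notin> controlled_junctions N"
  shows "ereal (inflow_to e flow) \<le> supply_at e"
proof (cases e rule: cell_cases)
  case source then show ?thesis using realized(6)[of e] by (simp add: inflow_to_source zero_ereal_def)
next
  case controlled then show ?thesis using assms by blast
next
  case (asymmetric a i)
  then show ?thesis
    using mainline_flow(2)[OF asymmetric, of u] asymmetric_junction(1)[OF asymmetric, of flow]
      asymmetric_junction(5)[OF asymmetric]
    by (simp add: flows_controlled add.commute)
next
  case (single i)
  then show ?thesis using single_flow(2)[of i e u] by (simp add: sole_inflow)
qed

text \<open>
  Even if the mainline flow at an asymmetric junction is negative, the total flow into the downstream
  cell is not: the mainline flow is at least \<open>- u $ a\<close>, where \<open>u $ a\<close> is the onramp flow.
\<close>
lemma inflow_nonneg: "0 \<le> inflow_to e flow"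
proof (cases e rule: cell_cases)
  case source then show ?thesis by (simp add: inflow_to_source)
next
  case controlled
  then have "0 \<le> \<beta> e i * flow $ i" for i
    by (cases "\<beta> e i = 0") (auto simp: flows_controlled u)
  then show ?thesis by (intro sum_nonneg) auto
next
  case (asymmetric a i)
  have "- (u $ a) \<le> flow $ i"
    using u[of a] asymmetric_junction(5)[OF asymmetric] realized(3)[of i] realized(6)[of e]
    by (intro mainline_flow(3)[OF asymmetric]) (auto simp: zero_ereal_def)
  then show ?thesis using asymmetric_junction(1)[OF asymmetric, of flow] asymmetric_junction(5)[OF asymmetric]
    by (simp add: flows_controlled)
next
  case (single i)
  have "0 \<le> flow $ i"
    using single realized(3)[of i] realized(6) by (intro single_flow(3)) (auto simp: zero_ereal_def)
  then show ?thesis using single by (simp add: sole_inflow)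
qed

lemma next_density_nonneg: "0 \<le> next_density N (realized_inflow \<omega> t) x flow $ e"
  by (rule density_stays_nonneg[where w = "realized_inflow \<omega> t",
        OF x_nonneg inflow_nonneg order_trans[OF flow_le_demand realized(5)] realized(1)])

end
end

lemma flows_cong: "(\<And>e. e \<in> C \<Longrightarrow> u $ e = u' $ e) \<Longrightarrow> flows N \<omega> t x u = flows N \<omega> t x u'"
  by (simp add: flows_def vec_eq_iff onramp_controlled Let_def)

lemma flows_idem: "flows N \<omega> t x (flows N \<omega> t x u) = flows N \<omega> t x u"
  by (rule flows_cong) (simp add: flows_controlled)

section \<open>Comparison of one time step\<close>

text \<open>
  The constraints on states and flows in the online problem, without nonnegativity of the uncontrolled
  flows.
\<close>
definition admissible :: "real ^ 'e \<Rightarrow> real ^ 'e \<Rightarrow> bool" where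
  "admissible x f \<longleftrightarrow> (\<forall>e. 0 \<le> x $ e) \<and> ramp_constraints N x \<and> (\<forall>e\<in>C. 0 \<le> f $ e) \<and>
     (\<forall>e. f $ e \<le> demand_lb N e (x $ e)) \<and>
     (\<forall>e. e \<notin> source_cells N \<longrightarrow> ereal (inflow_to e f) \<le> supply_lb N e (x $ e))"

lemma admissibleD:
  assumes "admissible x f"
  shows "0 \<le> x $ e" "ramp_constraints N x" "e \<in> C \<Longrightarrow> 0 \<le> f $ e" "f $ e \<le> demand_lb N e (x $ e)"
    "ereal (inflow_to e f) \<le> supply_lb N e (x $ e)"
proof -
  show "0 \<le> x $ e" "ramp_constraints N x" "e \<in> C \<Longrightarrow> 0 \<le> f $ e" "f $ e \<le> demand_lb N e (x $ e)"
    using assms by (simp_all add: admissible_def)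
  show "ereal (inflow_to e f) \<le> supply_lb N e (x $ e)"
    using assms by (cases "e \<in> source_cells N") (simp_all add: admissible_def source_supply)
qed

text \<open>
  Applying \<open>R\<close> amounts to routing with the controlled outflows removed, so facts about inflows apply to
  leads as well.
\<close>
lemma R_sum: "(\<Sum>i\<in>UNIV. R $ e $ i * d $ i) = inflow_to e (\<chi> i. if i \<in> C then 0 else d $ i)"
  by (auto intro!: sum.cong simp: reduced_routing_def)

text \<open>
  A source cell has no inflow, hence its density can only be lowered by a lead.
\<close>
lemma no_worse_ramp:
  assumes "no_worse x x'" "ramp_constraints N x'" shows "ramp_constraints N x"
proof -
  have "x $ e \<le> x' $ e" if "e \<in> source_cells N" for e
  proof -
    have "len e * (x' $ e - x $ e) = lead x x' $ e"
      by (simp only: lead_eq R_sum inflow_to_source[OF that] diff_zero)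
    then have "0 \<le> len e * (x' $ e - x $ e)" using assms(1) by (simp add: no_worse_lead)
    then show ?thesis by (simp add: len_mult_nonneg_iff)
  qed
  then show ?thesis using assms(2) by (force simp: ramp_constraints_def)
qed

text \<open>
  A density change of at most \<open>g / l\<close> moves demand and supply by at most \<open>g / \<Delta>t\<close>: this is what
  the CFL condition is for in the comparison.
\<close>
lemma per_length: 
  assumes "len e * r \<le> g" "0 \<le> g" shows "lip N * r \<le> g / dt"
proof -
  have "len e * (lip N * r * dt) \<le> lip N * dt * g"
    using mult_left_mono[OF assms(1), of "lip N * dt"] lip_nonneg by (simp add: algebra_simps)
  also have "\<dots> \<le> len e * g"
    using mult_right_mono[OF dt_lip[of e] assms(2)] by (simp add: algebra_simps)
  finally have "lip N * r * dt \<le> g" by (simp add: mult_le_cancel_left_pos)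
  then show ?thesis by (simp add: field_simps)
qed

lemma demand_shift:
  assumes "0 \<le> r" "0 \<le> r'" "len e * (r' - r) \<le> g" "0 \<le> g"
  shows "demand_lb N e r' - g / dt \<le> demand_lb N e r"
proof (cases "r \<le> r'")
  case True
  then show ?thesis using demand_lb_diff[OF assms(1) True, of e] per_length[OF assms(3,4)] by simp
next
  case False
  then have "demand_lb N e r' \<le> demand_lb N e r" using assms by (intro demand_lb_mono) auto
  moreover have "0 \<le> g / dt" using assms by (simp add: less_imp_le)
  ultimately show ?thesis by simp
qed

lemma supply_shift:
  assumes "0 \<le> r" "0 \<le> r'" "len e * (r - r') \<le> g" "0 \<le> g" and q: "ereal q \<le> supply_lb N e r'"
  shows "ereal (q - g / dt) \<le> supply_lb N e r"
proof -
  have "supply_lb N e r' \<le> supply_lb N e r + ereal (g / dt)"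
  proof (cases "r' \<le> r")
    case True
    have "supply_lb N e r' \<le> supply_lb N e r + ereal (lip N * (r - r'))"
      by (rule supply_lb_diff[OF assms(2) True])
    also have "\<dots> \<le> supply_lb N e r + ereal (g / dt)"
      using per_length[OF assms(3,4)] by (intro add_left_mono) simp
    finally show ?thesis .
  next
    case False
    then have "supply_lb N e r' \<le> supply_lb N e r" using assms by (intro supply_lb_antimono) auto
    moreover have "0 \<le> ereal (g / dt)" using assms by (simp add: less_imp_le)
    ultimately show ?thesis by (metis add_increasing2)
  qed
  then have "ereal q \<le> supply_lb N e r + ereal (g / dt)" by (rule order_trans[OF q])
  then show ?thesis by (cases "supply_lb N e r") auto
qed

context
  fixes \<omega> :: "'e realization" and t :: nat and x x' u f' :: "real ^ 'e"
  assumes uncertain: "\<omega> \<in> uncertainty_set N" "t \<le> horizon N" and x_nonneg: "\<And>e. 0 \<le> x $ e"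
    and admissible: "admissible x' f'" and no_worse: "no_worse x x'"
    and u: "\<And>e. e \<in> C \<Longrightarrow> u $ e = min (f' $ e) (demand_lb N e (x $ e))"
begin

lemmas bounds = realized[OF uncertain x_nonneg]

lemma lead_nonneg: "0 \<le> lead x x' $ e"
  using no_worse by (simp add: no_worse_lead)

lemma u_nonneg: "e \<in> C \<Longrightarrow> 0 \<le> u $ e"
  and u_le: "e \<in> C \<Longrightarrow> u $ e \<le> f' $ e" "e \<in> C \<Longrightarrow> u $ e \<le> demand_lb N e (x $ e)"
    "e \<in> C \<Longrightarrow> u $ e \<le> realized_demand \<omega> t e (x $ e)"
proof -
  assume e: "e \<in> C"
  show "0 \<le> u $ e" using admissibleD(3)[OF admissible e] x_nonneg u[OF e]
    by (simp add: demand_lb_nonneg)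
  show "u $ e \<le> f' $ e" "u $ e \<le> demand_lb N e (x $ e)" using u[OF e] by simp_all
  then show "u $ e \<le> realized_demand \<omega> t e (x $ e)" using bounds(4)[of e] by simp
qed

text \<open>
  The lead of a cell lowers its own density, by at most \<open>\<delta> i / l\<close>, and raises the density of the next
  cell, by at most \<open>\<beta> \<delta> i / l\<close>.  Hence the flow \<open>f' i - \<delta> i / \<Delta>t\<close> respects demand and supply at
  \<open>x\<close>, and the actual flow is the largest with this property.  At an asymmetric junction
  this uses that the onramp sends at most what \<open>f'\<close> prescribes.
\<close>
lemma catch_up: "f' $ i - lead x x' $ i / dt \<le> flows N \<omega> t x u $ i"
proof -
  let ?d = "lead x x'" let ?c = "f' $ i - ?d $ i / dt"
  note x' = admissibleD[OF admissible]
  have "len i * (x' $ i - x $ i) \<le> ?d $ i"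
    unfolding lead_eq by (simp add: sum_nonneg R_nonneg lead_nonneg)
  from demand_shift[OF x_nonneg x'(1) this lead_nonneg]
  have dem: "?c \<le> demand_lb N i (x $ i)" using x'(4)[of i] by linarith
  then have rdem: "?c \<le> realized_demand \<omega> t i (x $ i)" using bounds(4)[of i] by linarith
  have grow: "len e * (x $ e - x' $ e) \<le> (\<Sum>i\<in>UNIV. R $ e $ i * ?d $ i)" for e
    using lead_eq[of e x' x] lead_nonneg[of e] by (simp add: algebra_simps)
  have nonneg: "0 \<le> ?d $ i / dt" using lead_nonneg[of i] by (simp add: less_imp_le)
  show ?thesis
  proof (cases "i \<in> C")
    case True then show ?thesis using dem nonneg by (simp add: flows_controlled u)
  next
    case False
    show ?thesis
    proof (cases "hd_of i \<in> asym_junctions N")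
      case True
      obtain a j where A: "asymmetric_at N (hd_of i) a i j" using mainline_asymmetric False True by blast
      note J = asymmetric_junction[OF A]
      have "ereal (f' $ a + f' $ i) \<le> supply_lb N j (x' $ j)" using x'(5)[of j] J(1) by simp
      moreover have "len j * (x $ j - x' $ j) \<le> ?d $ i"
        using grow[of j] J(1)[of "\<chi> i. if i \<in> C then 0 else ?d $ i"] J(5,6) by (simp add: R_sum)
      ultimately have "ereal (f' $ a + f' $ i - ?d $ i / dt) \<le> supply_lb N j (x $ j)"
        by (intro supply_shift[OF x_nonneg x'(1) _ lead_nonneg])
      moreover have "?c + u $ a \<le> f' $ a + f' $ i - ?d $ i / dt" using u_le(1)[OF J(5)] by simp
      ultimately have "ereal (?c + u $ a) \<le> realized_supply \<omega> t j (x $ j)"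
        using bounds(7)[of j] by (meson ereal_less_eq(3) order_trans)
      then show ?thesis using rdem by (rule mainline_flow(3)[OF uncertain x_nonneg A, rotated])
    next
      case notasym: False
      have "ereal (\<beta> k i * ?c) \<le> realized_supply \<omega> t k (x $ k)" if k: "tl_of k = hd_of i" for k
      proof -
        have "ereal (\<beta> k i * f' $ i) \<le> supply_lb N k (x' $ k)"
          using x'(5)[of k] sole_inflow[OF False notasym k, of f'] by simp
        moreover have "len k * (x $ k - x' $ k) \<le> \<beta> k i * ?d $ i"
          using grow[of k] sole_inflow[OF False notasym k, of "\<chi> i. if i \<in> C then 0 else ?d $ i"] False
          by (simp add: R_sum)
        ultimately have "ereal (\<beta> k i * f' $ i - \<beta> k i * ?d $ i / dt) \<le> supply_lb N k (x $ k)"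
          by (intro supply_shift[OF x_nonneg x'(1)]) (auto simp: lead_nonneg)
        then have "ereal (\<beta> k i * ?c) \<le> supply_lb N k (x $ k)" by (simp add: right_diff_distrib)
        then show ?thesis using bounds(7)[of k] by order
      qed
      with rdem show ?thesis by (rule single_flow(3)[OF uncertain x_nonneg False notasym])
    qed
  qed
qed

text \<open>
  The new lead is at least \<open>\<delta> + \<Delta>t (f - f')\<close>, nonnegative by \<open>catch_up\<close>.  The remaining surplus consists of
  the controlled flow that \<open>u\<close> withholds in comparison with \<open>f'\<close> and of the external inflow that
  the realization lacks in comparison with its upper bound.
\<close>
lemma step_no_worse:
  "no_worse (next_density N (realized_inflow \<omega> t) x (flows N \<omega> t x u))
     (next_density N (inflow_bound N t) x' f')"
proof -
  define f where "f = flows N \<omega> t x u"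
  let ?d = "lead x x'"
  define d where "d = (\<chi> e. ?d $ e + dt * (f $ e - f' $ e))"
  define h :: "real ^ 'e" where "h = (\<chi> i. if i \<in> C then f' $ i - f $ i else 0)"
  define b :: "real ^ 'e" where
    "b = (\<chi> e. dt * inflow_to e h + dt * (inflow_bound N t e - realized_inflow \<omega> t e))"
  show ?thesis unfolding f_def[symmetric]
  proof (rule no_worseI[of b d])
    fix e
    have "0 \<le> ?d $ e / dt + (f $ e - f' $ e)" using catch_up[of e] by (simp add: f_def)
    then have "0 \<le> dt * (?d $ e / dt + (f $ e - f' $ e))" by (simp add: less_imp_le)
    then show "0 \<le> d $ e" by (simp add: d_def distrib_left less_imp_neq[OF dt_pos, symmetric])
    have "0 \<le> h $ i" for i
      by (simp add: h_def f_def flows_controlled u_le)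
    then show "0 \<le> b $ e"
      using bounds(2)[of e] by (auto simp: b_def intro!: add_nonneg_nonneg mult_nonneg_nonneg sum_nonneg less_imp_le[OF dt_pos])
    have split: "inflow_to e h + (\<Sum>i\<in>UNIV. R $ e $ i * (f' - f) $ i) = inflow_to e f' - inflow_to e f"
      unfolding R_sum sum.distrib[symmetric] sum_subtractf[symmetric]
      by (intro sum.cong) (auto simp: h_def algebra_simps)
    have Rd: "(\<Sum>i\<in>UNIV. R $ e $ i * d $ i)
        = (\<Sum>i\<in>UNIV. R $ e $ i * ?d $ i) - dt * (\<Sum>i\<in>UNIV. R $ e $ i * (f' - f) $ i)"
      unfolding d_def by (simp add: sum_distrib_left sum_subtractf[symmetric] algebra_simps)
    have step: "len e * next_density N w y g $ e = len e * y $ e + dt * (inflow_to e g - g $ e + w e)"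
      for w y g using less_imp_neq[OF len_pos[of e]] by (simp add: next_density_def distrib_left)
    have "b $ e + d $ e - (\<Sum>i\<in>UNIV. R $ e $ i * d $ i) =
        dt * (inflow_to e h + (\<Sum>i\<in>UNIV. R $ e $ i * (f' - f) $ i))
        + dt * (inflow_bound N t e - realized_inflow \<omega> t e) + dt * (f $ e - f' $ e)
        + (?d $ e - (\<Sum>i\<in>UNIV. R $ e $ i * ?d $ i))"
      unfolding Rd b_def by (simp add: d_def algebra_simps)
    also have "\<dots> = len e * (next_density N (inflow_bound N t) x' f' $ e
        - next_density N (realized_inflow \<omega> t) x f $ e)"
      unfolding split lead_eq[symmetric] right_diff_distrib[of "len e"] step
      by (simp add: algebra_simps)
    finally show "b $ e + d $ e - (\<Sum>i\<in>UNIV. R $ e $ i * d $ i) = len e *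
        (next_density N (inflow_bound N t) x' f' $ e - next_density N (realized_inflow \<omega> t) x f $ e)" .
  qed
qed

lemma step_nonneg: "0 \<le> next_density N (realized_inflow \<omega> t) x (flows N \<omega> t x u) $ e"
  by (rule next_density_nonneg[OF uncertain x_nonneg u_nonneg u_le(3)])

text \<open>
  All inflows of \<open>e\<close> are controlled, so no lead enters \<open>e\<close>.  Its density is at most that in \<open>x'\<close>, and
  its supply is at least as large.
\<close>
lemma controlled_junction_supply:
  assumes "tl_of e \<in> controlled_junctions N"
  shows "ereal (inflow_to e (flows N \<omega> t x u)) \<le> supply_lb N e (x $ e)"
proof -
  have C: "i \<in> C" if "\<beta> e i \<noteq> 0" for i
    using that assms beta_nonzero_iff[of e i] controlled_iff[of i] by metis
  have "inflow_to e (\<chi> i. if i \<in> C then 0 else lead x x' $ i) = 0"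
    using C by (intro sum.neutral) auto
  then have "0 \<le> len e * (x' $ e - x $ e)" using lead_nonneg by (simp add: lead_eq R_sum)
  then have le: "x $ e \<le> x' $ e" by (simp add: len_mult_nonneg_iff)
  have "\<beta> e i * flows N \<omega> t x u $ i \<le> \<beta> e i * f' $ i" for i
    using C[of i] by (cases "\<beta> e i = 0") (auto simp: flows_controlled u_le intro!: mult_left_mono)
  then have "inflow_to e (flows N \<omega> t x u) \<le> inflow_to e f'" by (intro sum_mono)
  then have "ereal (inflow_to e (flows N \<omega> t x u)) \<le> ereal (inflow_to e f')" by simp
  also have "\<dots> \<le> supply_lb N e (x' $ e)" by (rule admissibleD[OF admissible])
  also have "\<dots> \<le> supply_lb N e (x $ e)" by (rule supply_lb_antimono[OF x_nonneg le])
  finally show ?thesis .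
qed

lemma step_input_constraints: "input_constraints N \<omega> t x (flows N \<omega> t x u)"
  unfolding input_constraints_def
proof (intro conjI ballI allI impI)
  fix e assume e: "e \<in> C"
  show "0 \<le> flows N \<omega> t x u $ e" "flows N \<omega> t x u $ e \<le> realized_demand \<omega> t e (x $ e)"
    using e by (simp_all add: flows_controlled u_nonneg u_le)
next
  fix e assume "tl_of e \<in> controlled_junctions N"
  from order_trans[OF controlled_junction_supply[OF this] bounds(7)]
  show "ereal (inflow_to e (flows N \<omega> t x u)) \<le> realized_supply \<omega> t e (x $ e)" .
qed

end

lemma worst_case_admissible:
  assumes "t \<le> horizon N" and x: "\<And>e. 0 \<le> x $ e" and A: "admissible x' f'" and nw: "no_worse x x'"
    and u: "\<And>e. e \<in> C \<Longrightarrow> u $ e = min (f' $ e) (demand_lb N e (x $ e))"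
  shows "admissible x (flows N (worst_case N) t x u)"
proof -
  note H = worst_case_uncertain assms(1) x
  note hyp = H A nw u
  have ub: "\<And>e. e \<in> C \<Longrightarrow> 0 \<le> u $ e" "\<And>e. e \<in> C \<Longrightarrow> u $ e \<le> realized_demand (worst_case N) t e (x $ e)"
    using u_nonneg[OF hyp] u_le(3)[OF hyp] by blast+
  have "ereal (inflow_to e (flows N (worst_case N) t x u)) \<le> supply_lb N e (x $ e)" for e
    using controlled_junction_supply[OF hyp, of e] inflow_le_supply[OF H ub, of e] by auto
  then show ?thesis
    using no_worse_ramp[OF nw admissibleD(2)[OF A]] flow_le_demand[OF H ub] ub x
    by (simp add: admissible_def flows_controlled)
qed

section \<open>Relaxed plans and tracking\<close>

text \<open>
  A trajectory of the online problem on the time interval from \<open>a\<close> to \<open>b\<close>, without terminal constraint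
  and with possibly negative mainline flows.
\<close>
definition relaxed_plan :: "nat \<Rightarrow> nat \<Rightarrow> (nat \<Rightarrow> real ^ 'e) \<Rightarrow> (nat \<Rightarrow> real ^ 'e) \<Rightarrow> bool" where
  "relaxed_plan a b \<rho> \<phi> \<longleftrightarrow>
     (\<forall>\<tau>\<in>{a..<b}. \<rho> (Suc \<tau>) = next_density N (inflow_bound N \<tau>) (\<rho> \<tau>) (\<phi> \<tau>)) \<and>
     (\<forall>\<tau>\<in>{a..b}. admissible (\<rho> \<tau>) (\<phi> \<tau>))"

definition capped :: "real ^ 'e \<Rightarrow> real ^ 'e \<Rightarrow> real ^ 'e" where
  "capped f x = (\<chi> e. min (f $ e) (demand_lb N e (x $ e)))"

text \<open>
  The worst-case trajectory that starts in \<open>x\<close> at time \<open>a\<close> and tracks the flows \<open>\<phi>\<close>; the last argument counts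
  the steps since \<open>a\<close>.
\<close>
primrec follow :: "(nat \<Rightarrow> real ^ 'e) \<Rightarrow> nat \<Rightarrow> real ^ 'e \<Rightarrow> nat \<Rightarrow> real ^ 'e" where
  "follow \<phi> a x 0 = x"
| "follow \<phi> a x (Suc k) = next_density N (inflow_bound N (a + k)) (follow \<phi> a x k)
     (flows N (worst_case N) (a + k) (follow \<phi> a x k) (capped (\<phi> (a + k)) (follow \<phi> a x k)))"

lemma relaxed_planD:
  assumes "relaxed_plan a b \<rho> \<phi>"
  shows "a \<le> \<tau> \<Longrightarrow> \<tau> < b \<Longrightarrow> \<rho> (Suc \<tau>) = next_density N (inflow_bound N \<tau>) (\<rho> \<tau>) (\<phi> \<tau>)"
    "a \<le> \<tau> \<Longrightarrow> \<tau> \<le> b \<Longrightarrow> admissible (\<rho> \<tau>) (\<phi> \<tau>)"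
  using assms by (auto simp: relaxed_plan_def)

lemma relaxed_plan_suffix: "relaxed_plan a c \<rho> \<phi> \<Longrightarrow> a \<le> b \<Longrightarrow> relaxed_plan b c \<rho> \<phi>"
  by (simp add: relaxed_plan_def)

text \<open>
  Tracking stays admissible and ahead of its reference.  That \<open>\<phi>\<close> are the actual flows of the worst
  case makes the tracking trajectory realizable by a policy.
\<close>
lemma follow_plan:
  assumes plan: "relaxed_plan a b \<rho>' \<phi>'" and "a \<le> b" "b \<le> horizon N"
    and x: "\<And>e. 0 \<le> x $ e" and nw: "no_worse x (\<rho>' a)"
  obtains \<rho> \<phi> where "relaxed_plan a b \<rho> \<phi>" "\<rho> a = x"
    "\<And>\<tau>. a \<le> \<tau> \<Longrightarrow> \<tau> \<le> b \<Longrightarrow> no_worse (\<rho> \<tau>) (\<rho>' \<tau>)"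
    "\<And>\<tau>. \<phi> \<tau> = flows N (worst_case N) \<tau> (\<rho> \<tau>) (\<phi> \<tau>)"
proof -
  define \<rho> where "\<rho> \<tau> = follow \<phi>' a x (\<tau> - a)" for \<tau>
  define \<phi> where "\<phi> \<tau> = flows N (worst_case N) \<tau> (\<rho> \<tau>) (capped (\<phi>' \<tau>) (\<rho> \<tau>))" for \<tau>
  have next_\<rho>: "\<rho> (Suc \<tau>) = next_density N (inflow_bound N \<tau>) (\<rho> \<tau>) (\<phi> \<tau>)" if "a \<le> \<tau>" for \<tau>
    using that by (simp add: \<rho>_def \<phi>_def Suc_diff_le)
  note D = relaxed_planD[OF plan]
  have inv: "(\<forall>e. 0 \<le> \<rho> \<tau> $ e) \<and> no_worse (\<rho> \<tau>) (\<rho>' \<tau>)" if "a \<le> \<tau>" "\<tau> \<le> b" for \<tau>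
    using that
  proof (induction \<tau> rule: dec_induct)
    case base then show ?case using x nw by (simp add: \<rho>_def)
  next
    case (step \<tau>)
    then have IH: "\<And>e. 0 \<le> \<rho> \<tau> $ e" "no_worse (\<rho> \<tau>) (\<rho>' \<tau>)" and le: "\<tau> \<le> horizon N"
      using assms(3) by auto
    have A: "admissible (\<rho>' \<tau>) (\<phi>' \<tau>)" using D(2) step by simp
    have c: "\<And>e. e \<in> C \<Longrightarrow> capped (\<phi>' \<tau>) (\<rho> \<tau>) $ e = min (\<phi>' \<tau> $ e) (demand_lb N e (\<rho> \<tau> $ e))"
      by (simp add: capped_def)
    note hyp = worst_case_uncertain le IH(1) A IH(2) c
    have "\<rho>' (Suc \<tau>) = next_density N (inflow_bound N \<tau>) (\<rho>' \<tau>) (\<phi>' \<tau>)" using D(1) step by simp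
    then show ?case using step_nonneg[OF hyp] step_no_worse[OF hyp] step
      by (simp add: next_\<rho> \<phi>_def)
  qed
  show thesis
  proof (rule that)
    have "admissible (\<rho> \<tau>) (\<phi> \<tau>)" if "a \<le> \<tau>" "\<tau> \<le> b" for \<tau>
      unfolding \<phi>_def using inv[OF that] D(2)[OF that] that assms(3)
      by (intro worst_case_admissible[of _ _ "\<rho>' \<tau>" "\<phi>' \<tau>"]) (auto simp: capped_def)
    then show "relaxed_plan a b \<rho> \<phi>" using next_\<rho> by (simp add: relaxed_plan_def)
    show "\<rho> a = x" by (simp add: \<rho>_def)
    show "no_worse (\<rho> \<tau>) (\<rho>' \<tau>)" if "a \<le> \<tau>" "\<tau> \<le> b" for \<tau> using inv[OF that] by blast
    show "\<phi> \<tau> = flows N (worst_case N) \<tau> (\<rho> \<tau>) (\<phi> \<tau>)" for \<tau> by (simp add: \<phi>_def flows_idem)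
  qed
qed

text \<open>
  A plan can be continued by tracking a later plan, provided that its final state is no worse than the
  state in which the later plan starts.
\<close>
lemma relaxed_plan_append:
  assumes 1: "relaxed_plan a b \<rho>1 \<phi>1" and 2: "relaxed_plan b c \<rho>2 \<phi>2" and nw: "no_worse (\<rho>1 b) (\<rho>2 b)"
    and le: "a \<le> b" "b \<le> c" "c \<le> horizon N"
  obtains \<rho> \<phi> where "relaxed_plan a c \<rho> \<phi>" "\<And>\<tau>. \<tau> \<le> b \<Longrightarrow> \<rho> \<tau> = \<rho>1 \<tau>" "\<And>\<tau>. \<tau> < b \<Longrightarrow> \<phi> \<tau> = \<phi>1 \<tau>"
    "\<And>\<tau>. b \<le> \<tau> \<Longrightarrow> \<tau> \<le> c \<Longrightarrow> no_worse (\<rho> \<tau>) (\<rho>2 \<tau>)"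
proof -
  have "0 \<le> \<rho>1 b $ e" for e
    using admissibleD(1)[OF relaxed_planD(2)[OF 1, of b]] le by simp
  from follow_plan[OF 2 le(2,3) this nw] obtain \<rho>3 \<phi>3 where 3: "relaxed_plan b c \<rho>3 \<phi>3" "\<rho>3 b = \<rho>1 b"
    "\<And>\<tau>. b \<le> \<tau> \<Longrightarrow> \<tau> \<le> c \<Longrightarrow> no_worse (\<rho>3 \<tau>) (\<rho>2 \<tau>)" by metis
  define \<rho> where "\<rho> \<tau> = (if \<tau> \<le> b then \<rho>1 \<tau> else \<rho>3 \<tau>)" for \<tau>
  define \<phi> where "\<phi> \<tau> = (if \<tau> < b then \<phi>1 \<tau> else \<phi>3 \<tau>)" for \<tau>
  have late: "\<rho> \<tau> = \<rho>3 \<tau>" if "b \<le> \<tau>" for \<tau> using that 3(2) by (cases "\<tau> = b") (auto simp: \<rho>_def)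
  show thesis
  proof (rule that)
    show "relaxed_plan a c \<rho> \<phi>" unfolding relaxed_plan_def
    proof (intro conjI ballI)
      fix \<tau> assume "\<tau> \<in> {a..<c}"
      then show "\<rho> (Suc \<tau>) = next_density N (inflow_bound N \<tau>) (\<rho> \<tau>) (\<phi> \<tau>)"
        using relaxed_planD(1)[OF 1, of \<tau>] relaxed_planD(1)[OF 3(1), of \<tau>] late[of \<tau>] late[of "Suc \<tau>"]
        by (cases "\<tau> < b") (auto simp: \<phi>_def \<rho>_def)
    next
      fix \<tau> assume "\<tau> \<in> {a..c}"
      then show "admissible (\<rho> \<tau>) (\<phi> \<tau>)"
        using relaxed_planD(2)[OF 1, of \<tau>] relaxed_planD(2)[OF 3(1), of \<tau>] late[of \<tau>]
        by (cases "\<tau> < b") (auto simp: \<phi>_def \<rho>_def)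
    qed
    show "\<rho> \<tau> = \<rho>1 \<tau>" if "\<tau> \<le> b" for \<tau> using that by (simp add: \<rho>_def)
    show "\<phi> \<tau> = \<phi>1 \<tau>" if "\<tau> < b" for \<tau> using that by (simp add: \<phi>_def)
    show "no_worse (\<rho> \<tau>) (\<rho>2 \<tau>)" if "b \<le> \<tau>" "\<tau> \<le> c" for \<tau> using 3(3) late that by simp
  qed
qed

text \<open>
  Applying the controlled flows of a plan, for an arbitrary realization, leads to a state no worse than
  planned.
\<close>
lemma plan_step:
  assumes plan: "relaxed_plan t b \<rho> \<phi>" and t: "t \<le> b" "b \<le> horizon N" and \<omega>: "\<omega> \<in> uncertainty_set N"
    and u: "\<And>e. e \<in> C \<Longrightarrow> u $ e = \<phi> t $ e"
  shows "input_constraints N \<omega> t (\<rho> t) (flows N \<omega> t (\<rho> t) u)"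
    "0 \<le> next_density N (realized_inflow \<omega> t) (\<rho> t) (flows N \<omega> t (\<rho> t) u) $ e"
    "t < b \<Longrightarrow> no_worse (next_density N (realized_inflow \<omega> t) (\<rho> t) (flows N \<omega> t (\<rho> t) u)) (\<rho> (Suc t))"
proof -
  have A: "admissible (\<rho> t) (\<phi> t)" using relaxed_planD(2)[OF plan] t by simp
  have le: "t \<le> horizon N" using t by simp
  have c: "\<And>e. e \<in> C \<Longrightarrow> u $ e = min (\<phi> t $ e) (demand_lb N e (\<rho> t $ e))"
    using u admissibleD(4)[OF A] by (simp add: min_def)
  note hyp = \<omega> le admissibleD(1)[OF A] A no_worse_refl c
  show "input_constraints N \<omega> t (\<rho> t) (flows N \<omega> t (\<rho> t) u)"
    by (rule step_input_constraints[OF hyp])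
  show "0 \<le> next_density N (realized_inflow \<omega> t) (\<rho> t) (flows N \<omega> t (\<rho> t) u) $ e"
    by (rule step_nonneg[OF hyp])
  show "no_worse (next_density N (realized_inflow \<omega> t) (\<rho> t) (flows N \<omega> t (\<rho> t) u)) (\<rho> (Suc t))"
    if "t < b"
    using step_no_worse[OF hyp] relaxed_planD(1)[OF plan, of t] that by simp
qed

section \<open>Policies built from relaxed plans\<close>

text \<open>
  The first control of some relaxed plan that reaches the horizon.  By \<open>safe_next\<close> a safe control leads
  to a state with a safe control again, whatever the realization, so choosing safe controls yields
  feasible policies.
\<close>
definition safe_input :: "nat \<Rightarrow> real ^ 'e \<Rightarrow> real ^ 'e \<Rightarrow> bool" where
  "safe_input t x u \<longleftrightarrow>
     (\<exists>\<rho> \<phi>. relaxed_plan t (horizon N) \<rho> \<phi> \<and> \<rho> t = x \<and> (\<forall>e\<in>C. u $ e = \<phi> t $ e))"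

lemma safe_next:
  assumes "safe_input t x u" "t < horizon N" "\<omega> \<in> uncertainty_set N"
  shows "\<exists>u'. safe_input (Suc t) (next_density N (realized_inflow \<omega> t) x (flows N \<omega> t x u)) u'"
proof -
  obtain \<rho> \<phi> where plan: "relaxed_plan t (horizon N) \<rho> \<phi>" "\<rho> t = x" "\<And>e. e \<in> C \<Longrightarrow> u $ e = \<phi> t $ e"
    using assms(1) by (auto simp: safe_input_def)
  let ?y = "next_density N (realized_inflow \<omega> t) (\<rho> t) (flows N \<omega> t (\<rho> t) u)"
  have y: "\<And>e. 0 \<le> ?y $ e" "no_worse ?y (\<rho> (Suc t))"
    using plan_step(2,3)[OF plan(1) _ _ assms(3) plan(3)] assms(2) by auto
  have "relaxed_plan (Suc t) (horizon N) \<rho> \<phi>" using relaxed_plan_suffix[OF plan(1)] by simp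
  from follow_plan[OF this _ _ y] assms(2) obtain \<rho>' \<phi>'
    where "relaxed_plan (Suc t) (horizon N) \<rho>' \<phi>'" "\<rho>' (Suc t) = ?y" by (metis Suc_leI order_refl)
  then show ?thesis unfolding plan(2) safe_input_def by blast
qed

lemma safe_inputD:
  assumes "safe_input t x u" "t \<le> horizon N"
  shows "0 \<le> x $ e" "ramp_constraints N x" "e \<in> C \<Longrightarrow> 0 \<le> u $ e"
    "\<omega> \<in> uncertainty_set N \<Longrightarrow> input_constraints N \<omega> t x (flows N \<omega> t x u)"
proof -
  obtain \<rho> \<phi> where plan: "relaxed_plan t (horizon N) \<rho> \<phi>" "\<rho> t = x" "\<And>e. e \<in> C \<Longrightarrow> u $ e = \<phi> t $ e"
    using assms(1) by (auto simp: safe_input_def)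
  have A: "admissible x (\<phi> t)" using relaxed_planD(2)[OF plan(1), of t] plan(2) assms(2) by simp
  show "0 \<le> x $ e" "ramp_constraints N x" using admissibleD[OF A] by auto
  show "e \<in> C \<Longrightarrow> 0 \<le> u $ e" using admissibleD(3)[OF A] plan(3) by simp
  show "\<omega> \<in> uncertainty_set N \<Longrightarrow> input_constraints N \<omega> t x (flows N \<omega> t x u)"
    using plan_step(1)[OF plan(1) assms(2) order_refl _ plan(3)] unfolding plan(2) .
qed

lemma feasible_policyI:
  assumes "is_policy N \<pi>"
    and safe: "\<And>\<omega> t. \<omega> \<in> uncertainty_set N \<Longrightarrow> t \<le> horizon N \<Longrightarrow>
      safe_input t (closed_loop N \<pi> \<omega> t) (\<pi> t (closed_loop N \<pi> \<omega> t))"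
  shows "\<pi> \<in> feasible_policies N"
  using assms(1) safe_inputD(2,4)[OF safe]
  by (auto simp: feasible_policies_def closed_loop_flows_def)

text \<open>
  The policy that applies \<open>u\<close> on the trajectory \<open>z\<close>, and any safe control elsewhere, is feasible and has \<open>z\<close> as its
  closed loop.  So the assumption on asymmetric junctions covers every trajectory with safe controls.
\<close>
lemma onramp_fits:
  assumes asym: "asymmetric_assumption N" and \<omega>: "\<omega> \<in> uncertainty_set N"
    and z0: "z 0 = initial_density N"
    and z: "\<And>t. t < horizon N \<Longrightarrow>
      z (Suc t) = next_density N (realized_inflow \<omega> t) (z t) (flows N \<omega> t (z t) (u t))"
    and safe: "\<And>t. t \<le> horizon N \<Longrightarrow> safe_input t (z t) (u t)"
    and at: "asymmetric_at N v a i j" and t: "t \<le> horizon N"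
  shows "ereal (realized_demand \<omega> t a (z t $ a)) \<le> realized_supply \<omega> t j (z t $ j)"
proof -
  define \<pi> :: "'e policy" where "\<pi> t x =
    (if t \<le> horizon N \<and> x = z t then u t
     else if \<exists>u. safe_input t x u then SOME u. safe_input t x u else 0)" for t x
  have \<pi>: "safe_input t x (\<pi> t x)" if "\<exists>u. safe_input t x u" for t x
    using that safe someI_ex[of "safe_input t x"] by (auto simp: \<pi>_def)
  have "is_policy N \<pi>" unfolding is_policy_def
  proof (intro allI impI ballI)
    fix t :: nat and x :: "real ^ 'e" and e assume t: "t \<le> horizon N" and e: "e \<in> C"
    show "0 \<le> \<pi> t x $ e"
    proof (cases "\<exists>u. safe_input t x u")
      case True then show ?thesis using safe_inputD(3)[OF \<pi> t e] by simp
    next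
      case False
      then have "\<pi> t x = 0" using safe[OF t] by (auto simp: \<pi>_def)
      then show ?thesis by simp
    qed
  qed
  moreover have "safe_input s (closed_loop N \<pi> \<omega>' s) (\<pi> s (closed_loop N \<pi> \<omega>' s))"
    if \<omega>': "\<omega>' \<in> uncertainty_set N" and s: "s \<le> horizon N" for \<omega>' s
    using s
  proof (induction s)
    case 0
    show ?case using safe[of 0] z0 by (intro \<pi>) auto
  next
    case (Suc s)
    then show ?case using safe_next[OF _ _ \<omega>', of s] by (intro \<pi>) auto
  qed
  ultimately have feas: "\<pi> \<in> feasible_policies N" by (rule feasible_policyI)
  have "closed_loop N \<pi> \<omega> s = z s" if "s \<le> horizon N" for s
    using that
  proof (induction s)
    case 0 then show ?case using z0 by simp
  next
    case (Suc s)
    then have "\<pi> s (z s) = u s" by (simp add: \<pi>_def)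
    with Suc show ?case by (simp add: z)
  qed
  then show ?thesis using asym at \<omega> feas t unfolding asymmetric_assumption_def by metis
qed

lemma nominal_plan:
  assumes "fnc_feasible N (worst_case N) \<rho> \<phi>"
  shows "relaxed_plan 0 (horizon N) \<rho> \<phi>"
proof -
  let ?\<omega> = "worst_case N"
  have step: "\<rho> (Suc t) = next_density N (inflow_bound N t) (\<rho> t) (\<phi> t)" if "t < horizon N" for t
    using assms that by (simp add: fnc_feasible_def)
  have D: "\<phi> t = flows N ?\<omega> t (\<rho> t) (\<phi> t)" "input_constraints N ?\<omega> t (\<rho> t) (\<phi> t)"
      "ramp_constraints N (\<rho> t)" if "t \<le> horizon N" for t
    using assms that by (auto simp: fnc_feasible_def)
  have u: "0 \<le> \<phi> t $ e" "\<phi> t $ e \<le> realized_demand ?\<omega> t e (\<rho> t $ e)" if "t \<le> horizon N" "e \<in> C" for t e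
    using D(2)[OF that(1)] that(2) by (auto simp: input_constraints_def)
  have nonneg: "\<forall>e. 0 \<le> \<rho> t $ e" if "t \<le> horizon N" for t
    using that
  proof (induction t)
    case 0
    then show ?case using assms diagram
      by (auto simp: fnc_feasible_def fundamental_diagram_def density_range_def)
  next
    case (Suc t)
    then have t: "t \<le> horizon N" and x: "\<And>e. 0 \<le> \<rho> t $ e" by auto
    show ?case
      using next_density_nonneg[OF worst_case_uncertain t x u[OF t]] D(1)[OF t] step[of t] Suc.prems
      by simp
  qed
  have "admissible (\<rho> t) (\<phi> t)" if t: "t \<le> horizon N" for t
  proof -
    have x: "0 \<le> \<rho> t $ e" for e using nonneg[OF t] by simp
    note H = worst_case_uncertain t x u[OF t]
    have "\<phi> t $ e \<le> demand_lb N e (\<rho> t $ e)" for e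
      using flow_le_demand[OF H, of e] D(1)[OF t] by simp
    moreover have "ereal (inflow_to e (\<phi> t)) \<le> supply_lb N e (\<rho> t $ e)" for e
      using inflow_le_supply[OF H, of e] D(1,2)[OF t]
      by (cases "tl_of e \<in> controlled_junctions N") (auto simp: input_constraints_def)
    ultimately show ?thesis using x u(1)[OF t] D(3)[OF t] by (simp add: admissible_def)
  qed
  then show ?thesis using step by (simp add: relaxed_plan_def)
qed

lemma flows_realization_cong:
  assumes "realized_demand \<omega> t = realized_demand \<omega>' t'" "realized_supply \<omega> t = realized_supply \<omega>' t'"
  shows "flows N \<omega> t x u = flows N \<omega>' t' x u"
  unfolding flows_def assms by (rule refl)

text \<open>
  Tracking a plan from the state reached so far gives nonnegative flows.  The trajectory consisting of the
  closed loop up to time \<open>t\<close> and the tracking trajectory afterwards belongs to the realization that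
  switches from \<open>\<omega>\<close> to the worst case at time \<open>t\<close>, and all its controls are safe.  Hence the
  onramp demand fits into the supply along it, which leaves a nonnegative mainline flow.
\<close>
lemma nonnegative_plan:
  assumes asym: "asymmetric_assumption N" and \<omega>: "\<omega> \<in> uncertainty_set N"
    and z0: "z 0 = initial_density N"
    and z: "\<And>s. s < t \<Longrightarrow>
      z (Suc s) = next_density N (realized_inflow \<omega> s) (z s) (flows N \<omega> s (z s) (u s))"
    and safe: "\<And>s. s < t \<Longrightarrow> safe_input s (z s) (u s)"
    and plan: "relaxed_plan t (horizon N) \<rho>' \<phi>'" and t: "t \<le> horizon N"
    and zt: "\<And>e. 0 \<le> z t $ e" and nw: "no_worse (z t) (\<rho>' t)"
  obtains \<rho> \<phi> where "relaxed_plan t (horizon N) \<rho> \<phi>" "\<rho> t = z t"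
    "\<And>\<tau>. t \<le> \<tau> \<Longrightarrow> \<tau> \<le> horizon N \<Longrightarrow> no_worse (\<rho> \<tau>) (\<rho>' \<tau>)"
    "\<And>\<tau> e. t \<le> \<tau> \<Longrightarrow> \<tau> \<le> horizon N \<Longrightarrow> 0 \<le> \<phi> \<tau> $ e"
proof -
  from follow_plan[OF plan t order_refl zt nw] obtain \<rho> \<phi> where
    new: "relaxed_plan t (horizon N) \<rho> \<phi>" "\<rho> t = z t"
    "\<And>\<tau>. t \<le> \<tau> \<Longrightarrow> \<tau> \<le> horizon N \<Longrightarrow> no_worse (\<rho> \<tau>) (\<rho>' \<tau>)"
    and \<phi>: "\<And>\<tau>. \<phi> \<tau> = flows N (worst_case N) \<tau> (\<rho> \<tau>) (\<phi> \<tau>)"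
    by metis
  define \<omega>' where "\<omega>' = \<lparr>
    realized_inflow = (\<lambda>s. if s < t then realized_inflow \<omega> s else inflow_bound N s),
    realized_demand = (\<lambda>s. if s < t then realized_demand \<omega> s else demand_lb N),
    realized_supply = (\<lambda>s. if s < t then realized_supply \<omega> s else supply_lb N)\<rparr>"
  have \<omega>': "\<omega>' \<in> uncertainty_set N"
    unfolding uncertainty_set_def
  proof (intro CollectI allI impI)
    fix s e assume "s \<le> horizon N"
    then show "0 \<le> realized_inflow \<omega>' s e \<and> realized_inflow \<omega>' s e \<le> inflow_bound N s e \<and>
     (e \<notin> source_cells N \<longrightarrow> realized_inflow \<omega>' s e = 0) \<and>
     (\<forall>\<rho>\<ge>0. 0 \<le> realized_demand \<omega>' s e \<rho> \<and> demand_lb N e \<rho> \<le> realized_demand \<omega>' s e \<rho> \<and>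
             realized_demand \<omega>' s e \<rho> \<le> lip N * \<rho>) \<and>
     (\<forall>\<rho>\<ge>0. 0 \<le> realized_supply \<omega>' s e \<rho> \<and> supply_lb N e \<rho> \<le> realized_supply \<omega>' s e \<rho> \<and>
             (jam_density N e \<noteq> \<infinity> \<longrightarrow> realized_supply \<omega>' s e \<rho> \<noteq> \<infinity>))"
      using \<omega> worst_case_uncertain
      by (cases "s < t") (simp_all add: \<omega>'_def uncertainty_set_def worst_case_def)
  qed
  have early: "flows N \<omega>' s x v = flows N \<omega> s x v" "realized_inflow \<omega>' s = realized_inflow \<omega> s"
    if "s < t" for s x v
    using that by (auto simp: \<omega>'_def intro!: flows_realization_cong)
  have late: "flows N \<omega>' s x v = flows N (worst_case N) s x v" "realized_inflow \<omega>' s = inflow_bound N s"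
    "realized_demand \<omega>' s = demand_lb N" "realized_supply \<omega>' s = supply_lb N"
    if "\<not> s < t" for s x v
    using that by (auto simp: \<omega>'_def worst_case_def intro!: flows_realization_cong)
  define z' where "z' s = (if s \<le> t then z s else \<rho> s)" for s
  define u' where "u' s = (if s < t then u s else \<phi> s)" for s
  have z'_late: "z' s = \<rho> s" if "t \<le> s" for s
    using that new(2) by (cases "s = t") (simp_all add: z'_def)
  have dyn: "z' (Suc s) = next_density N (realized_inflow \<omega>' s) (z' s) (flows N \<omega>' s (z' s) (u' s))"
    if "s < horizon N" for s
  proof (cases "s < t")
    case True then show ?thesis using z[of s] by (simp add: early z'_def u'_def)
  next
    case False
    then show ?thesis
      using relaxed_planD(1)[OF new(1), of s] that \<phi>[of s] z'_late[of s] z'_late[of "Suc s"]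
      by (simp add: late u'_def)
  qed
  have safe': "safe_input s (z' s) (u' s)" if "s \<le> horizon N" for s
  proof (cases "s < t")
    case True then show ?thesis using safe[of s] by (simp add: z'_def u'_def)
  next
    case False
    then show ?thesis using relaxed_plan_suffix[OF new(1), of s] z'_late[of s]
      unfolding safe_input_def by (intro exI[of _ \<rho>] exI[of _ \<phi>]) (simp add: u'_def)
  qed
  have fits: "ereal (demand_lb N a (\<rho> s $ a)) \<le> supply_lb N j (\<rho> s $ j)"
    if "asymmetric_at N v a i j" "t \<le> s" "s \<le> horizon N" for v a i j s
    using onramp_fits[where z = z' and u = u', OF asym \<omega>' _ dyn safe' that(1,3)] that(2) z0 z'_late[of s]
    by (simp add: late z'_def)
  have "0 \<le> \<phi> \<tau> $ e" if \<tau>: "t \<le> \<tau>" "\<tau> \<le> horizon N" for \<tau> e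
  proof -
    have A: "admissible (\<rho> \<tau>) (\<phi> \<tau>)" using relaxed_planD(2)[OF new(1) \<tau>] .
    note adm = admissibleD[OF A]
    note H = worst_case_uncertain \<tau>(2) adm(1)
    consider "e \<in> C" | "e \<notin> C" "hd_of e \<in> asym_junctions N" | "e \<notin> C" "hd_of e \<notin> asym_junctions N"
      by blast
    then show ?thesis
    proof cases
      case 1 then show ?thesis by (rule adm(3))
    next
      case 2
      then obtain a j where at: "asymmetric_at N (hd_of e) a e j" using mainline_asymmetric by blast
      have "ereal (0 + \<phi> \<tau> $ a) \<le> ereal (demand_lb N a (\<rho> \<tau> $ a))" using adm(4)[of a] by simp
      also have "\<dots> \<le> supply_lb N j (\<rho> \<tau> $ j)" by (rule fits[OF at \<tau>])
      finally have "0 \<le> flows N (worst_case N) \<tau> (\<rho> \<tau>) (\<phi> \<tau>) $ e"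
        using demand_lb_nonneg[OF adm(1)] by (intro mainline_flow(3)[OF H at]) simp_all
      then show ?thesis using \<phi>[of \<tau>] by simp
    next
      case 3
      have "0 \<le> flows N (worst_case N) \<tau> (\<rho> \<tau>) (\<phi> \<tau>) $ e"
        using demand_lb_nonneg[OF adm(1)] supply_lb_nonneg[OF adm(1)]
        by (intro single_flow(3)[OF H 3]) (simp_all add: zero_ereal_def[symmetric])
      then show ?thesis using \<phi>[of \<tau>] by simp
    qed
  qed
  with new show thesis by (rule that)
qed

section \<open>The online optimization problem\<close>

abbreviation ending :: "nat \<Rightarrow> nat \<Rightarrow> nat" where "ending \<equiv> control_end N"

lemma ending_le: "ending Tc t \<le> horizon N" by (simp add: control_end_def)
lemma le_ending: "t \<le> horizon N \<Longrightarrow> t \<le> ending Tc t" by (simp add: control_end_def)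

lemma inflow_bound_nonneg: "t \<le> horizon N \<Longrightarrow> 0 \<le> inflow_bound N t e"
  using inflow by (simp add: inflow_bounds_ok_def)

lemma mpc_feasibleD:
  assumes F: "mpc_feasible N Tc \<rho>o t x \<rho> \<phi>" and x: "\<And>e. 0 \<le> x $ e" and t: "t \<le> horizon N"
  shows "relaxed_plan t (ending Tc t) \<rho> \<phi>" "\<rho> t = x" "no_worse (\<rho> (ending Tc t)) (\<rho>o (ending Tc t))"
    "t \<le> \<tau> \<Longrightarrow> \<tau> \<le> ending Tc t \<Longrightarrow> 0 \<le> \<phi> \<tau> $ e"
proof -
  have step: "\<rho> (Suc \<tau>) = next_density N (inflow_bound N \<tau>) (\<rho> \<tau>) (\<phi> \<tau>)"
    if "t \<le> \<tau>" "\<tau> < ending Tc t" for \<tau> using F that by (simp add: mpc_feasible_def)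
  have D: "ramp_constraints N (\<rho> \<tau>)" "0 \<le> \<phi> \<tau> $ e" "\<phi> \<tau> $ e \<le> demand_lb N e (\<rho> \<tau> $ e)"
    "e \<notin> source_cells N \<Longrightarrow> ereal (inflow_to e (\<phi> \<tau>)) \<le> supply_lb N e (\<rho> \<tau> $ e)"
    if "t \<le> \<tau>" "\<tau> \<le> ending Tc t" for \<tau> e using F that by (simp_all add: mpc_feasible_def)
  show 0: "\<rho> t = x" "no_worse (\<rho> (ending Tc t)) (\<rho>o (ending Tc t))"
    using F by (simp_all add: mpc_feasible_def no_worse_def)
  have "\<forall>e. 0 \<le> \<rho> \<tau> $ e" if "t \<le> \<tau>" "\<tau> \<le> ending Tc t" for \<tau>
    using that
  proof (induction \<tau> rule: dec_induct)
    case base then show ?case using 0 x by simp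
  next
    case (step \<tau>)
    have le: "\<tau> \<le> ending Tc t" "\<tau> \<le> horizon N" using step ending_le[of Tc t] by auto
    have nonneg: "0 \<le> \<rho> \<tau> $ e" for e using step by simp
    have "\<phi> \<tau> $ e \<le> lip N * \<rho> \<tau> $ e" for e
      using D(3)[OF step(1) le(1), of e] demand_lb_le_lip[OF nonneg, of e e] by simp
    then have "0 \<le> next_density N (inflow_bound N \<tau>) (\<rho> \<tau>) (\<phi> \<tau>) $ e" for e
      using D(2)[OF step(1) le(1)] nonneg inflow_bound_nonneg[OF le(2)]
      by (intro density_stays_nonneg sum_nonneg mult_nonneg_nonneg) auto
    then show ?case using \<open>\<And>\<tau>. t \<le> \<tau> \<Longrightarrow> \<tau> < ending Tc t \<Longrightarrow> _\<close>[of \<tau>] step by simp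
  qed
  then have "admissible (\<rho> \<tau>) (\<phi> \<tau>)" if "t \<le> \<tau>" "\<tau> \<le> ending Tc t" for \<tau>
    using that D[OF that] by (simp add: admissible_def)
  then show "relaxed_plan t (ending Tc t) \<rho> \<phi>" using step by (simp add: relaxed_plan_def)
  show "t \<le> \<tau> \<Longrightarrow> \<tau> \<le> ending Tc t \<Longrightarrow> 0 \<le> \<phi> \<tau> $ e" by (rule D(2))
qed

lemma mpc_feasibleI:
  assumes plan: "relaxed_plan t (horizon N) \<rho> \<phi>"
    and nonneg: "\<And>\<tau> e. t \<le> \<tau> \<Longrightarrow> \<tau> \<le> horizon N \<Longrightarrow> 0 \<le> \<phi> \<tau> $ e"
    and nw: "no_worse (\<rho> (ending Tc t)) (\<rho>o (ending Tc t))"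
  shows "mpc_feasible N Tc \<rho>o t (\<rho> t) \<rho> \<phi>"
  unfolding mpc_feasible_def
proof (intro conjI ballI allI impI)
  fix \<tau> assume \<tau>: "\<tau> \<in> {t..<ending Tc t}"
  show "\<rho> (Suc \<tau>) = next_density N (inflow_bound N \<tau>) (\<rho> \<tau>) (\<phi> \<tau>)"
    using relaxed_planD(1)[OF plan, of \<tau>] \<tau> ending_le[of Tc t] by simp
next
  fix \<tau> e assume \<tau>: "\<tau> \<in> {t..ending Tc t}"
  then have A: "admissible (\<rho> \<tau>) (\<phi> \<tau>)" and le: "t \<le> \<tau>" "\<tau> \<le> horizon N"
    using relaxed_planD(2)[OF plan, of \<tau>] ending_le[of Tc t] by auto
  show "ramp_constraints N (\<rho> \<tau>)" "0 \<le> \<phi> \<tau> $ e" "\<phi> \<tau> $ e \<le> demand_lb N e (\<rho> \<tau> $ e)"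
    "ereal (inflow_to e (\<phi> \<tau>)) \<le> supply_lb N e (\<rho> \<tau> $ e)"
    using admissibleD[OF A] nonneg[OF le] by auto
qed (use nw in \<open>auto simp: no_worse_def\<close>)

section \<open>Existence of online minimizers\<close>

text \<open>
  Given the flows, the dynamics determine the trajectory.  So the online problem is a problem about flow
  sequences, a space with the product topology.  The last argument counts the steps since \<open>t\<close>.
\<close>
primrec roll :: "nat \<Rightarrow> real ^ 'e \<Rightarrow> (nat \<Rightarrow> real ^ 'e) \<Rightarrow> nat \<Rightarrow> real ^ 'e" where
  "roll t x \<phi> 0 = x"
| "roll t x \<phi> (Suc k) = next_density N (inflow_bound N (t + k)) (roll t x \<phi> k) (\<phi> (t + k))"

lemma continuous_roll: "continuous_on UNIV (\<lambda>\<phi>. roll t x \<phi> k)"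
proof (induction k)
  case 0 then show ?case by simp
next
  case (Suc k)
  then show ?case unfolding roll.simps next_density_def
    by (intro continuous_intros continuous_on_product_coordinates)
qed

lemma clip_lip: "0 \<le> x \<Longrightarrow> 0 \<le> y \<Longrightarrow> \<bar>clip e x - clip e y\<bar> \<le> \<bar>x - y\<bar>"
  using clip_diff[of x y e] clip_diff[of y x e] by linarith

lemma continuous_clipped:
  fixes f :: "real \<Rightarrow> real"
  assumes f: "\<And>x y. x \<in> density_range N e \<Longrightarrow> y \<in> density_range N e \<Longrightarrow> \<bar>f x - f y\<bar> \<le> lip N * \<bar>x - y\<bar>"
  shows "continuous_on UNIV (\<lambda>r. f (clip e (max 0 r)))"
proof (rule lipschitz_on_continuous_on[of "lip N"], rule lipschitz_onI)
  fix r s :: real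
  have "\<bar>f (clip e (max 0 r)) - f (clip e (max 0 s))\<bar> \<le> lip N * \<bar>clip e (max 0 r) - clip e (max 0 s)\<bar>"
    by (intro f clip_range) auto
  also have "\<dots> \<le> lip N * \<bar>r - s\<bar>"
    using clip_lip[of "max 0 r" "max 0 s" e] lip_nonneg
    by (intro mult_left_mono) (auto simp: max_def split: if_splits)
  finally show "dist (f (clip e (max 0 r))) (f (clip e (max 0 s))) \<le> lip N * dist r s"
    by (simp add: dist_real_def)
qed (rule lip_nonneg)

lemma mpc_feasible_roll:
  assumes F: "mpc_feasible N Tc \<rho>o t x \<rho> \<phi>" and "t \<le> \<tau>" "\<tau> \<le> ending Tc t"
  shows "\<rho> \<tau> = roll t x \<phi> (\<tau> - t)"
  using assms(2,3)
proof (induction \<tau> rule: dec_induct)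
  case base then show ?case using F by (simp add: mpc_feasible_def)
next
  case (step \<tau>)
  then show ?case using F by (simp add: mpc_feasible_def Suc_diff_le)
qed

text \<open>
  In each step the inflow is bounded, because the flows are at most \<open>\<gamma>\<close> times the densities of the
  previous step.
\<close>
lemma mpc_feasible_bounded:
  assumes x: "\<And>e. 0 \<le> x $ e" and t: "t \<le> horizon N" and "t \<le> \<tau>" "\<tau> \<le> ending Tc t"
  shows "\<exists>B. \<forall>\<rho> \<phi>. mpc_feasible N Tc \<rho>o t x \<rho> \<phi> \<longrightarrow> (\<forall>e. \<rho> \<tau> $ e \<le> B)"
  using assms(3,4)
proof (induction \<tau> rule: dec_induct)
  case base
  have "x $ e \<le> Max (range (($) x))" for e by (intro Max_ge) auto
  then show ?case by (intro exI[of _ "Max (range (($) x))"]) (simp add: mpc_feasible_def)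
next
  case (step \<tau>)
  then obtain B where B: "\<And>\<rho> \<phi> e. mpc_feasible N Tc \<rho>o t x \<rho> \<phi> \<Longrightarrow> \<rho> \<tau> $ e \<le> B" by auto
  define G where "G e = B + dt / len e * ((\<Sum>i\<in>UNIV. \<beta> e i * (lip N * B)) + inflow_bound N \<tau> e)" for e
  have "\<rho> (Suc \<tau>) $ e \<le> Max (range G)" if F: "mpc_feasible N Tc \<rho>o t x \<rho> \<phi>" for \<rho> \<phi> e
  proof -
    note D = mpc_feasibleD[OF F x t]
    have le: "t \<le> \<tau>" "\<tau> \<le> ending Tc t" "\<tau> < ending Tc t" using step by auto
    note adm = admissibleD[OF relaxed_planD(2)[OF D(1) le(1,2)]]
    have "\<phi> \<tau> $ i \<le> lip N * B" for i
      using adm(4)[of i] demand_lb_le_lip[OF adm(1), of i i] mult_left_mono[OF B[OF F] lip_nonneg, of i]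
      by linarith
    then have "inflow_to e (\<phi> \<tau>) \<le> (\<Sum>i\<in>UNIV. \<beta> e i * (lip N * B))"
      by (intro sum_mono mult_left_mono) auto
    then have "inflow_to e (\<phi> \<tau>) - \<phi> \<tau> $ e + inflow_bound N \<tau> e
        \<le> (\<Sum>i\<in>UNIV. \<beta> e i * (lip N * B)) + inflow_bound N \<tau> e"
      using D(4)[OF le(1,2), of e] by simp
    then have "dt / len e * (inflow_to e (\<phi> \<tau>) - \<phi> \<tau> $ e + inflow_bound N \<tau> e)
        \<le> dt / len e * ((\<Sum>i\<in>UNIV. \<beta> e i * (lip N * B)) + inflow_bound N \<tau> e)"
      by (intro mult_left_mono) auto
    then have "\<rho> (Suc \<tau>) $ e \<le> G e"
      using relaxed_planD(1)[OF D(1) le(1,3)] B[OF F, of e] by (simp add: next_density_def G_def)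
    also have "\<dots> \<le> Max (range G)" by (intro Max_ge) auto
    finally show ?thesis .
  qed
  then show ?case by blast
qed

lemma mpc_feasible_cong:
  assumes "\<And>\<tau>. t \<le> \<tau> \<Longrightarrow> \<tau> \<le> ending Tc t \<Longrightarrow> \<rho> \<tau> = \<rho>' \<tau> \<and> \<phi> \<tau> = \<phi>' \<tau>" and t: "t \<le> horizon N"
  shows "mpc_feasible N Tc \<rho>o t x \<rho> \<phi> \<longleftrightarrow> mpc_feasible N Tc \<rho>o t x \<rho>' \<phi>'"
proof -
  have "\<rho> t = \<rho>' t" "\<rho> (ending Tc t) = \<rho>' (ending Tc t)" using assms(1) le_ending[OF t] by auto
  moreover have "(\<forall>\<tau>\<in>{t..<ending Tc t}. \<rho> (Suc \<tau>) = next_density N (inflow_bound N \<tau>) (\<rho> \<tau>) (\<phi> \<tau>)) \<longleftrightarrow>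
    (\<forall>\<tau>\<in>{t..<ending Tc t}. \<rho>' (Suc \<tau>) = next_density N (inflow_bound N \<tau>) (\<rho>' \<tau>) (\<phi>' \<tau>))"
    using assms(1) by (intro ball_cong refl) simp
  moreover have "(\<forall>\<tau>\<in>{t..ending Tc t}. Q (\<rho> \<tau>) (\<phi> \<tau>)) \<longleftrightarrow> (\<forall>\<tau>\<in>{t..ending Tc t}. Q (\<rho>' \<tau>) (\<phi>' \<tau>))" for Q
    using assms(1) by (intro ball_cong refl) simp
  note this[of "\<lambda>r f. ramp_constraints N r \<and> (\<forall>e. 0 \<le> f $ e \<and> f $ e \<le> demand_lb N e (r $ e)) \<and>
    (\<forall>e. e \<notin> source_cells N \<longrightarrow> ereal (inflow_to e f) \<le> supply_lb N e (r $ e))"]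
  ultimately show ?thesis unfolding mpc_feasible_def by (simp only:)
qed

text \<open>
  Feasibility in terms of functions that are continuous on the whole space: the nominal functions say
  nothing about negative densities, so these are cut off before the functions are applied.
\<close>
lemma mpc_feasible_compact_form:
  assumes x: "\<And>e. 0 \<le> x $ e" and t: "t \<le> horizon N"
  shows "mpc_feasible N Tc \<rho>o t x (\<lambda>\<tau>. roll t x \<phi> (\<tau> - t)) \<phi> \<longleftrightarrow>
    (\<forall>\<tau>. \<tau> \<in> {t..ending Tc t} \<longrightarrow> (\<forall>e. 0 \<le> roll t x \<phi> (\<tau> - t) $ e \<and>
      (e \<in> source_cells N \<longrightarrow> roll t x \<phi> (\<tau> - t) $ e \<le> ramp_limit N e) \<and> 0 \<le> \<phi> \<tau> $ e \<and>
      \<phi> \<tau> $ e \<le> nominal_demand N e (clip e (max 0 (roll t x \<phi> (\<tau> - t) $ e))) \<and>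
      (e \<notin> source_cells N \<and> jam_density N e \<noteq> \<infinity> \<longrightarrow>
        inflow_to e (\<phi> \<tau>) \<le> nominal_supply N e (clip e (max 0 (roll t x \<phi> (\<tau> - t) $ e)))))) \<and>
    (\<forall>e. ((P ** L_matrix N) *v (roll t x \<phi> (ending Tc t - t) - \<rho>o (ending Tc t))) $ e \<le> 0)"
    (is "?L \<longleftrightarrow> ?R")
proof -
  have fits: "ereal q \<le> supply_lb N e r \<longleftrightarrow>
      (jam_density N e \<noteq> \<infinity> \<longrightarrow> q \<le> nominal_supply N e (clip e r))" if "0 \<le> r" for q e r
    using that by (cases "jam_density N e = \<infinity>") (simp_all add: supply_lb_clip, simp add: supply_lb_def)
  have dyn: "roll t x \<phi> (Suc \<tau> - t) =
      next_density N (inflow_bound N \<tau>) (roll t x \<phi> (\<tau> - t)) (\<phi> \<tau>)" if "t \<le> \<tau>" for \<tau>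
    using that by (simp add: Suc_diff_le)
  show ?thesis
  proof
    assume F: ?L
    note D = mpc_feasibleD[OF F x t]
    have "0 \<le> roll t x \<phi> (\<tau> - t) $ e" if "\<tau> \<in> {t..ending Tc t}" for \<tau> e
      using admissibleD(1)[OF relaxed_planD(2)[OF D(1), of \<tau>]] that by simp
    then show ?R using F
      by (simp add: mpc_feasible_def ramp_constraints_def less_eq_vec_def demand_lb_clip fits)
  next
    assume R: ?R
    have nonneg: "0 \<le> roll t x \<phi> (\<tau> - t) $ e" if "\<tau> \<in> {t..ending Tc t}" for \<tau> e
      using R that by blast
    then have clipped: "max 0 (roll t x \<phi> (\<tau> - t) $ e) = roll t x \<phi> (\<tau> - t) $ e"
      if "\<tau> \<in> {t..ending Tc t}" for \<tau> e using that by (simp add: max_def)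
    have terminal: "(P ** L_matrix N) *v (roll t x \<phi> (ending Tc t - t) - \<rho>o (ending Tc t)) \<le> 0"
      using R by (simp add: less_eq_vec_def)
    have at: "ramp_constraints N (roll t x \<phi> (\<tau> - t))" "0 \<le> \<phi> \<tau> $ e"
      "\<phi> \<tau> $ e \<le> demand_lb N e (roll t x \<phi> (\<tau> - t) $ e)"
      "e \<notin> source_cells N \<Longrightarrow> ereal (inflow_to e (\<phi> \<tau>)) \<le> supply_lb N e (roll t x \<phi> (\<tau> - t) $ e)"
      if \<tau>: "\<tau> \<in> {t..ending Tc t}" for \<tau> e
      using R[THEN conjunct1, rule_format, OF \<tau>] clipped[OF \<tau>] nonneg[OF \<tau>]
      by (simp_all add: ramp_constraints_def demand_lb_clip fits)
    show ?L unfolding mpc_feasible_def using at dyn terminal by simp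
  qed
qed

text \<open>
  The feasible flow sequences form a closed set.  Outside the control window they may be set to zero, and
  inside they are bounded, so a product of boxes, compact by Tychonoff, contains enough of them.
\<close>
lemma mpc_minimizer_exists:
  assumes F0: "mpc_feasible N Tc \<rho>o t x \<rho>0 \<phi>0" and x: "\<And>e. 0 \<le> x $ e" and t: "t \<le> horizon N"
  shows "\<exists>\<rho> \<phi>. mpc_minimizer N Tc \<rho>o t x \<rho> \<phi>"
proof -
  define traj where "traj \<phi> \<tau> = roll t x \<phi> (\<tau> - t)" for \<phi> \<tau>
  define F where "F = {\<phi>. mpc_feasible N Tc \<rho>o t x (traj \<phi>) \<phi>}"
  define W where "W = {t..ending Tc t}"
  have traj: "continuous_on UNIV (\<lambda>\<phi>. traj \<phi> \<tau> $ e)" for \<tau> e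
    unfolding traj_def by (intro continuous_intros continuous_roll)
  have coord: "continuous_on UNIV (\<lambda>\<phi> :: nat \<Rightarrow> real ^ 'e. \<phi> \<tau> $ e)" for \<tau> e
    by (intro continuous_intros continuous_on_product_coordinates)
  have terminal: "continuous_on UNIV (\<lambda>\<phi>. ((P ** L_matrix N) *v (traj \<phi> \<tau> - y)) $ e)" for \<tau> y e
    unfolding traj_def
    by (intro continuous_on_component continuous_on_compose2[OF matrix_vector_mult_linear_continuous_on]
        continuous_intros continuous_roll) auto
  have "closed F"
    unfolding F_def traj_def mpc_feasible_compact_form[OF x t]
    unfolding traj_def[symmetric]
    by (intro closed_Collect_conj closed_Collect_all closed_Collect_const_imp closed_Collect_le
        continuous_on_const continuous_on_sum continuous_on_mult_left traj coord terminal
        continuous_on_compose2[OF continuous_clipped[OF nominal_demand_facts(2)] traj]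
        continuous_on_compose2[OF continuous_clipped[OF nominal_supply_facts(2)] traj])
      auto
  have "\<exists>B. \<forall>\<rho> \<phi>. mpc_feasible N Tc \<rho>o t x \<rho> \<phi> \<longrightarrow> \<tau> \<in> W \<longrightarrow> (\<forall>e. \<rho> \<tau> $ e \<le> B)" for \<tau>
    using mpc_feasible_bounded[OF x t, of \<tau> Tc \<rho>o] by (cases "\<tau> \<in> W") (auto simp: W_def)
  then obtain B where B: "\<And>\<rho> \<phi> \<tau> e. mpc_feasible N Tc \<rho>o t x \<rho> \<phi> \<Longrightarrow> \<tau> \<in> W \<Longrightarrow> \<rho> \<tau> $ e \<le> B \<tau>"
    by metis
  (* the maximum with 0 keeps the zero flow in every box *)
  define K where "K = (\<Pi>\<^sub>E \<tau>\<in>UNIV. cbox (0 :: real ^ 'e) (\<chi> e. lip N * max 0 (B \<tau>)))"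
  have "compact K"
    using compactin_PiE[of "\<lambda>_. euclidean" UNIV "\<lambda>\<tau>. cbox (0 :: real ^ 'e) (\<chi> e. lip N * max 0 (B \<tau>))"]
    by (simp add: K_def euclidean_product_topology)
  define cut where "cut \<phi> \<tau> = (if \<tau> \<in> W then \<phi> \<tau> else 0)" for \<phi> :: "nat \<Rightarrow> real ^ 'e" and \<tau>
  have cut: "cut \<phi> \<in> K \<inter> F \<and> (\<forall>\<tau>\<in>W. traj (cut \<phi>) \<tau> = \<rho> \<tau>)"
    if F: "mpc_feasible N Tc \<rho>o t x \<rho> \<phi>" for \<rho> \<phi>
  proof -
    have F': "mpc_feasible N Tc \<rho>o t x \<rho> (cut \<phi>)"
      using F mpc_feasible_cong[OF _ t, of Tc \<rho> \<rho> \<phi> "cut \<phi>"] by (simp add: cut_def W_def)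
    have eq: "traj (cut \<phi>) \<tau> = \<rho> \<tau>" if "\<tau> \<in> W" for \<tau>
      using mpc_feasible_roll[OF F', of \<tau>] that by (simp add: traj_def W_def)
    then have "cut \<phi> \<in> F"
      using F' mpc_feasible_cong[OF _ t, of Tc "traj (cut \<phi>)" \<rho> "cut \<phi>" "cut \<phi>"]
      by (simp add: F_def W_def)
    moreover have "cut \<phi> \<tau> \<in> cbox 0 (\<chi> e. lip N * max 0 (B \<tau>))" for \<tau>
    proof (cases "\<tau> \<in> W")
      case True
      note D = mpc_feasibleD[OF F x t]
      have le: "t \<le> \<tau>" "\<tau> \<le> ending Tc t" using True by (auto simp: W_def)
      note adm = admissibleD[OF relaxed_planD(2)[OF D(1) le]]
      have "\<phi> \<tau> $ e \<le> lip N * max 0 (B \<tau>)" for e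
      proof -
        have "\<phi> \<tau> $ e \<le> lip N * \<rho> \<tau> $ e" using adm(4)[of e] demand_lb_le_lip[OF adm(1), of e e] by simp
        also have "\<dots> \<le> lip N * max 0 (B \<tau>)"
          using B[OF F True, of e] lip_nonneg by (intro mult_left_mono) auto
        finally show ?thesis .
      qed
      then show ?thesis using True D(4)[OF le] by (simp add: cut_def mem_box_cart)
    next
      case False then show ?thesis using lip_nonneg by (simp add: cut_def mem_box_cart)
    qed
    ultimately show ?thesis using eq by (simp add: K_def PiE_def extensional_def)
  qed
  have "continuous_on (K \<inter> F) (\<lambda>\<phi>. mpc_objective N Tc t (traj \<phi>))"
    unfolding mpc_objective_def
    by (intro continuous_intros continuous_on_subset[OF traj]) auto
  moreover have "compact (K \<inter> F)" using \<open>compact K\<close> \<open>closed F\<close> by (rule compact_Int_closed)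
  moreover have "K \<inter> F \<noteq> {}" using cut[OF F0] by blast
  ultimately obtain \<phi> where \<phi>: "\<phi> \<in> K \<inter> F"
    "\<And>\<phi>'. \<phi>' \<in> K \<inter> F \<Longrightarrow> mpc_objective N Tc t (traj \<phi>) \<le> mpc_objective N Tc t (traj \<phi>')"
    using continuous_attains_inf[of "K \<inter> F"] by blast
  have "mpc_objective N Tc t (traj \<phi>) \<le> mpc_objective N Tc t \<rho>'"
    if "mpc_feasible N Tc \<rho>o t x \<rho>' \<phi>'" for \<rho>' \<phi>'
  proof -
    have "mpc_objective N Tc t (traj (cut \<phi>')) = mpc_objective N Tc t \<rho>'"
      using cut[OF that] unfolding mpc_objective_def by (intro sum.cong) (auto simp: W_def)
    then show ?thesis using \<phi>(2) cut[OF that] by metis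
  qed
  then show ?thesis using \<phi>(1) unfolding mpc_minimizer_def F_def by blast
qed

section \<open>The closed loop and its cost\<close>

lemma TTS_mass: "TTS N \<rho> = dt * (\<Sum>t\<le>horizon N. mass (\<rho> t))"
  by (simp add: TTS_def mass_def)

lemma objective_mass: "mpc_objective N Tc t \<rho> = (\<Sum>\<tau>\<in>{Suc t..ending Tc t}. mass (\<rho> \<tau>))"
  by (simp add: mpc_objective_def mass_def)

text \<open>
  The worst case is one of the admitted realizations, and against it any feasible policy produces a
  feasible trajectory of the deterministic problem.
\<close>
lemma nominal_le_robust_value:
  assumes "fnc_optimizer N (worst_case N) \<rho>o \<phi>o"
  shows "ereal (TTS N \<rho>o) \<le> robust_value N"
  unfolding robust_value_def
proof (rule INF_greatest)
  fix \<pi> assume \<pi>: "\<pi> \<in> feasible_policies N"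
  let ?w = "worst_case N"
  have "fnc_feasible N ?w (closed_loop N \<pi> ?w) (closed_loop_flows N \<pi> ?w)"
    using \<pi> worst_case_uncertain
    by (auto simp: fnc_feasible_def feasible_policies_def closed_loop_flows_def flows_idem)
  then have "TTS N \<rho>o \<le> TTS N (closed_loop N \<pi> ?w)"
    using assms unfolding fnc_optimizer_def by blast
  then show "ereal (TTS N \<rho>o) \<le> (SUP \<omega>\<in>uncertainty_set N. ereal (TTS N (closed_loop N \<pi> \<omega>)))"
    using worst_case_uncertain by (intro SUP_upper2[of ?w]) auto
qed

lemma mpc_policy_exists: "\<exists>\<pi>. mpc_policy N Tc \<rho>o \<pi>"
proof -
  define \<pi> :: "'e policy" where "\<pi> t x = (if \<exists>\<rho> \<phi>. mpc_minimizer N Tc \<rho>o t x \<rho> \<phi>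
    then (SOME \<phi>. \<exists>\<rho>. mpc_minimizer N Tc \<rho>o t x \<rho> \<phi>) t else 0)" for t x
  have \<pi>: "\<exists>\<rho> \<phi>. mpc_minimizer N Tc \<rho>o t x \<rho> \<phi> \<and> \<pi> t x = \<phi> t"
    if "\<exists>\<rho> \<phi>. mpc_minimizer N Tc \<rho>o t x \<rho> \<phi>" for t x
  proof -
    have "\<exists>\<phi> \<rho>. mpc_minimizer N Tc \<rho>o t x \<rho> \<phi>" using that by blast
    from someI_ex[OF this] show ?thesis using that unfolding \<pi>_def by auto
  qed
  have "0 \<le> \<pi> t x $ e" if t: "t \<le> horizon N" for t x e
  proof (cases "\<exists>\<rho> \<phi>. mpc_minimizer N Tc \<rho>o t x \<rho> \<phi>")
    case True
    from \<pi>[OF this] show ?thesis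
      using le_ending[OF t, of Tc] by (auto simp: mpc_minimizer_def mpc_feasible_def)
  next
    case False
    then have "\<pi> t x = 0" unfolding \<pi>_def by (simp only: if_False)
    then show ?thesis by simp
  qed
  then have "mpc_policy N Tc \<rho>o \<pi>"
    using \<pi> unfolding mpc_policy_def is_policy_def by metis
  then show ?thesis by blast
qed

context
  fixes Tc :: nat and \<rho>o \<phi>o :: "nat \<Rightarrow> real ^ 'e" and \<pi> :: "'e policy" and \<omega> :: "'e realization"
  assumes asym: "asymmetric_assumption N" and Tc: "1 \<le> Tc"
    and nominal: "fnc_feasible N (worst_case N) \<rho>o \<phi>o"
    and \<pi>: "mpc_policy N Tc \<rho>o \<pi>" and \<omega>: "\<omega> \<in> uncertainty_set N"
begin

abbreviation z :: "nat \<Rightarrow> real ^ 'e" where "z \<equiv> closed_loop N \<pi> \<omega>"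
abbreviation T :: nat where "T \<equiv> horizon N"

text \<open>
  The cost from time \<open>a\<close> on of a plan made at time \<open>t\<close>, which is charged with its own mass inside the
  control window and with that of the nominal optimizer afterwards.
\<close>
definition cost_to_go :: "nat \<Rightarrow> nat \<Rightarrow> (nat \<Rightarrow> real ^ 'e) \<Rightarrow> real" where
  "cost_to_go a t \<rho> = (\<Sum>\<tau>\<in>{a..T}. if \<tau> \<le> ending Tc t then mass (\<rho> \<tau>) else mass (\<rho>o \<tau>))"

text \<open>
  The invariant of the closed loop.  Tracking the plan \<open>\<rho>\<close> will give a feasible point of the next
  online problem, and its cost together with the cost incurred so far is at most the nominal cost.
\<close>
definition reference :: "nat \<Rightarrow> (nat \<Rightarrow> real ^ 'e) \<Rightarrow> bool" where
  "reference t \<rho> \<longleftrightarrow> (\<exists>\<phi>. relaxed_plan t T \<rho> \<phi>) \<and> (\<forall>e. 0 \<le> z t $ e) \<and> no_worse (z t) (\<rho> t) \<and>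
     (\<forall>\<tau>. ending Tc t \<le> \<tau> \<longrightarrow> \<tau> \<le> T \<longrightarrow> no_worse (\<rho> \<tau>) (\<rho>o \<tau>)) \<and>
     (\<Sum>s<t. mass (z s)) + cost_to_go t t \<rho> \<le> (\<Sum>s\<le>T. mass (\<rho>o s))"

text \<open>
  Tracking the reference gives a feasible point \<open>\<rho>1\<close>, the policy applies a minimizer \<open>\<rho>2\<close>, and the
  continuation \<open>\<rho>3\<close> of the minimizer by the nominal optimizer is the next reference.  Its cost is at
  most that of \<open>\<rho>2\<close>, hence of \<open>\<rho>1\<close> and of the old reference.
\<close>
lemma solve_and_apply:
  assumes t: "t \<le> T" and ref: "reference t \<rho>'"
    and past: "\<And>s. s < t \<Longrightarrow> safe_input s (z s) (\<pi> s (z s))"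
  obtains \<rho> where "\<exists>\<rho> \<phi>. mpc_minimizer N Tc \<rho>o t (z t) \<rho> \<phi>" "safe_input t (z t) (\<pi> t (z t))"
    "t < T \<Longrightarrow> reference (Suc t) \<rho>"
proof -
  let ?c = "ending Tc t"
  have c: "t \<le> ?c" "?c \<le> T" using t by (simp_all add: le_ending ending_le)
  from ref obtain \<phi>' where plan: "relaxed_plan t T \<rho>' \<phi>'" and zt: "\<And>e. 0 \<le> z t $ e"
    and nw: "no_worse (z t) (\<rho>' t)"
    and tail: "\<And>\<tau>. ?c \<le> \<tau> \<Longrightarrow> \<tau> \<le> T \<Longrightarrow> no_worse (\<rho>' \<tau>) (\<rho>o \<tau>)"
    and cost: "(\<Sum>s<t. mass (z s)) + cost_to_go t t \<rho>' \<le> (\<Sum>s\<le>T. mass (\<rho>o s))"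
    unfolding reference_def by blast
  obtain \<rho>1 \<phi>1 where 1: "relaxed_plan t T \<rho>1 \<phi>1" "\<rho>1 t = z t"
    "\<And>\<tau>. t \<le> \<tau> \<Longrightarrow> \<tau> \<le> T \<Longrightarrow> no_worse (\<rho>1 \<tau>) (\<rho>' \<tau>)"
    "\<And>\<tau> e. t \<le> \<tau> \<Longrightarrow> \<tau> \<le> T \<Longrightarrow> 0 \<le> \<phi>1 \<tau> $ e"
    by (rule nonnegative_plan[where z = z and u = "\<lambda>s. \<pi> s (z s)", OF asym \<omega> _ _ past plan t zt nw]) auto
  have "mpc_feasible N Tc \<rho>o t (\<rho>1 t) \<rho>1 \<phi>1"
    using 1 c no_worse_trans[OF _ tail] by (intro mpc_feasibleI) auto
  then have F1: "mpc_feasible N Tc \<rho>o t (z t) \<rho>1 \<phi>1" using 1(2) by simp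
  have ex: "\<exists>\<rho> \<phi>. mpc_minimizer N Tc \<rho>o t (z t) \<rho> \<phi>" by (rule mpc_minimizer_exists[OF F1 zt t])
  then obtain \<rho>2 \<phi>2 where min: "mpc_minimizer N Tc \<rho>o t (z t) \<rho>2 \<phi>2"
    and u: "\<And>e. e \<in> C \<Longrightarrow> \<pi> t (z t) $ e = \<phi>2 t $ e"
    using \<pi> t unfolding mpc_policy_def by metis
  have F2: "mpc_feasible N Tc \<rho>o t (z t) \<rho>2 \<phi>2"
    and opt: "mpc_objective N Tc t \<rho>2 \<le> mpc_objective N Tc t \<rho>1"
    using min F1 by (auto simp: mpc_minimizer_def)
  note D = mpc_feasibleD[OF F2 zt t]
  obtain \<rho>3 \<phi>3 where 3: "relaxed_plan t T \<rho>3 \<phi>3" "\<And>\<tau>. \<tau> \<le> ?c \<Longrightarrow> \<rho>3 \<tau> = \<rho>2 \<tau>"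
    "\<And>\<tau>. \<tau> < ?c \<Longrightarrow> \<phi>3 \<tau> = \<phi>2 \<tau>" "\<And>\<tau>. ?c \<le> \<tau> \<Longrightarrow> \<tau> \<le> T \<Longrightarrow> no_worse (\<rho>3 \<tau>) (\<rho>o \<tau>)"
    using relaxed_plan_append[OF D(1) relaxed_plan_suffix[OF nominal_plan[OF nominal]] D(3) c order_refl]
    by auto
  have start: "\<rho>3 t = z t" using 3(2)[OF c(1)] D(2) by simp
  have safe: "safe_input t (z t) (\<pi> t (z t))"
  proof (cases "t < T")
    case True
    (* the control window is longer than one instant, so the continuation keeps the first flows *)
    then have "t < ?c" using Tc by (simp add: control_end_def)
    then show ?thesis unfolding safe_input_def using 3(1,3) start u
      by (intro exI[of _ \<rho>3] exI[of _ \<phi>3]) simp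
  next
    case False
    then have "?c = T" using t by (simp add: control_end_def)
    then show ?thesis unfolding safe_input_def using D(1,2) u
      by (intro exI[of _ \<rho>2] exI[of _ \<phi>2]) simp
  qed
  have "reference (Suc t) \<rho>3" if less: "t < T"
  proof -
    have tc: "t < ?c" using Tc less by (simp add: control_end_def)
    have u3: "\<And>e. e \<in> C \<Longrightarrow> \<pi> t (z t) $ e = \<phi>3 t $ e" using u 3(3)[OF tc] by simp
    have step: "0 \<le> z (Suc t) $ e" "no_worse (z (Suc t)) (\<rho>3 (Suc t))" for e
      using plan_step(2,3)[OF 3(1) t order_refl \<omega> u3] less by (simp_all add: start)
    have "cost_to_go (Suc t) (Suc t) \<rho>3 \<le> cost_to_go (Suc t) t \<rho>2"
      unfolding cost_to_go_def
    proof (rule sum_mono)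
      fix \<tau> assume \<tau>: "\<tau> \<in> {Suc t..T}"
      have "?c \<le> ending Tc (Suc t)" by (simp add: control_end_def)
      then show "(if \<tau> \<le> ending Tc (Suc t) then mass (\<rho>3 \<tau>) else mass (\<rho>o \<tau>))
          \<le> (if \<tau> \<le> ?c then mass (\<rho>2 \<tau>) else mass (\<rho>o \<tau>))"
        using 3(2)[of \<tau>] no_worse_mass[OF 3(4), of \<tau>] \<tau> by auto
    qed
    also have "cost_to_go (Suc t) t \<rho>2 \<le> cost_to_go (Suc t) t \<rho>1"
      using opt c unfolding cost_to_go_def objective_mass by (simp add: sum_two_phase)
    also have "cost_to_go (Suc t) t \<rho>1 \<le> cost_to_go (Suc t) t \<rho>'"
      unfolding cost_to_go_def using no_worse_mass[OF 1(3)] by (intro sum_mono) auto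
    finally have "cost_to_go (Suc t) (Suc t) \<rho>3 \<le> cost_to_go (Suc t) t \<rho>'" .
    moreover have "mass (z t) + cost_to_go (Suc t) t \<rho>' \<le> cost_to_go t t \<rho>'"
      using t c no_worse_mass[OF nw] unfolding cost_to_go_def by (simp add: sum.atLeast_Suc_atMost)
    ultimately have "mass (z t) + cost_to_go (Suc t) (Suc t) \<rho>3 \<le> cost_to_go t t \<rho>'" by simp
    then have "(\<Sum>s<Suc t. mass (z s)) + cost_to_go (Suc t) (Suc t) \<rho>3 \<le> (\<Sum>s\<le>T. mass (\<rho>o s))"
      using cost by simp
    moreover have "relaxed_plan (Suc t) T \<rho>3 \<phi>3" using relaxed_plan_suffix[OF 3(1)] by simp
    moreover have "no_worse (\<rho>3 \<tau>) (\<rho>o \<tau>)" if "ending Tc (Suc t) \<le> \<tau>" "\<tau> \<le> T" for \<tau>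
      using that by (intro 3(4)) (auto simp: control_end_def)
    ultimately show ?thesis using step unfolding reference_def by blast
  qed
  with ex safe show thesis by (rule that)
qed

lemma reference_start: "reference 0 \<rho>o"
proof -
  have "0 \<le> \<rho>o 0 $ e" for e
    using admissibleD(1)[OF relaxed_planD(2)[OF nominal_plan[OF nominal]], of 0] by simp
  moreover have "\<rho>o 0 = z 0" using nominal by (simp add: fnc_feasible_def)
  moreover have "cost_to_go 0 0 \<rho>o = (\<Sum>s\<le>T. mass (\<rho>o s))"
    by (simp add: cost_to_go_def atMost_atLeast0)
  ultimately show ?thesis
    using nominal_plan[OF nominal] no_worse_refl unfolding reference_def by auto
qed

lemma reference_exists:
  "t \<le> T \<Longrightarrow> (\<exists>\<rho>. reference t \<rho>) \<and> (\<forall>s<t. safe_input s (z s) (\<pi> s (z s)))"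
proof (induction t)
  case 0 then show ?case using reference_start by blast
next
  case (Suc t)
  then obtain \<rho> where \<rho>: "reference t \<rho>" and past: "\<And>s. s < t \<Longrightarrow> safe_input s (z s) (\<pi> s (z s))"
    by auto
  have "t \<le> T" "t < T" using Suc.prems by auto
  from solve_and_apply[OF this(1) \<rho> past] this(2)
  obtain \<rho>3 where "safe_input t (z t) (\<pi> t (z t))" "reference (Suc t) \<rho>3" by metis
  then show ?case using past less_Suc_eq by auto
qed

lemma mpc_closed_loop:
  assumes t: "t \<le> T"
  shows "\<exists>\<rho> \<phi>. mpc_minimizer N Tc \<rho>o t (z t) \<rho> \<phi>" "safe_input t (z t) (\<pi> t (z t))"
  using reference_exists[OF t] solve_and_apply[OF t] by metis+

lemma mpc_cost: "TTS N z \<le> TTS N \<rho>o"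
proof -
  obtain \<rho> where \<rho>: "reference T \<rho>" using reference_exists by blast
  have "mass (z T) \<le> mass (\<rho> T)" using \<rho> no_worse_mass by (simp add: reference_def)
  moreover have "cost_to_go T T \<rho> = mass (\<rho> T)" by (simp add: cost_to_go_def control_end_def)
  ultimately have "(\<Sum>s<T. mass (z s)) + mass (z T) \<le> (\<Sum>s\<le>T. mass (\<rho>o s))"
    using \<rho> by (simp add: reference_def)
  moreover have "(\<Sum>s\<le>T. mass (z s)) = (\<Sum>s<T. mass (z s)) + mass (z T)"
    by (simp add: lessThan_Suc_atMost[symmetric])
  ultimately show ?thesis unfolding TTS_mass by (intro mult_left_mono) auto
qed

end

end

theorem proposition2:
  fixes N :: "('v, 'e::finite) fnc_network"
    and Tc :: nat
    and \<rho>opt \<phi>opt :: "nat \<Rightarrow> real ^ 'e"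
  assumes "fnc_assumptions N"
    and "Tc \<ge> 1"
    and "fnc_optimizer N (worst_case N) \<rho>opt \<phi>opt"
  shows "(\<exists>\<pi>. mpc_policy N Tc \<rho>opt \<pi>) \<and>
    (\<forall>\<pi>. mpc_policy N Tc \<rho>opt \<pi> \<longrightarrow>
       (\<forall>\<omega>\<in>uncertainty_set N. \<forall>t\<le>horizon N.
          \<exists>\<rho> \<phi>. mpc_minimizer N Tc \<rho>opt t (closed_loop N \<pi> \<omega> t) \<rho> \<phi>) \<and>
       \<pi> \<in> feasible_policies N \<and>
       (\<forall>\<omega>\<in>uncertainty_set N. ereal (TTS N (closed_loop N \<pi> \<omega>)) \<le> robust_value N))"
proof -
  interpret traffic_network N
    using assms(1) by unfold_locales (auto simp: fnc_assumptions_def)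
  have asym: "asymmetric_assumption N" using assms(1) by (simp add: fnc_assumptions_def)
  have nominal: "fnc_feasible N (worst_case N) \<rho>opt \<phi>opt" using assms(3) by (simp add: fnc_optimizer_def)
  show ?thesis
  proof (intro conjI allI impI ballI)
    show "\<exists>\<pi>. mpc_policy N Tc \<rho>opt \<pi>" by (rule mpc_policy_exists)
  next
    fix \<pi> assume \<pi>: "mpc_policy N Tc \<rho>opt \<pi>"
    note closed = mpc_closed_loop[OF asym assms(2) nominal \<pi>]
    show "\<exists>\<rho> \<phi>. mpc_minimizer N Tc \<rho>opt t (closed_loop N \<pi> \<omega> t) \<rho> \<phi>"
      if "\<omega> \<in> uncertainty_set N" "t \<le> horizon N" for \<omega> t
      using closed(1) that by blast
    show "\<pi> \<in> feasible_policies N"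
      using \<pi> closed(2) by (intro feasible_policyI) (auto simp: mpc_policy_def)
    fix \<omega> assume \<omega>: "\<omega> \<in> uncertainty_set N"
    have "ereal (TTS N (closed_loop N \<pi> \<omega>)) \<le> ereal (TTS N \<rho>opt)"
      using mpc_cost[OF asym assms(2) nominal \<pi> \<omega>] by simp
    also have "\<dots> \<le> robust_value N" by (rule nominal_le_robust_value[OF assms(3)])
    finally show "ereal (TTS N (closed_loop N \<pi> \<omega>)) \<le> robust_value N" .
  qed
qed

end
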